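(* Let $1\le i\le m<n$ be integers. The number of $i$-dimensional faces of an $m$-dimensional local tropical linear space in $\mathbb{R}^n$ which become bounded after modding out by the lineality space generated by the vector $(1,\dots,1)$ is at most \[ \binom{n-i-1}{n-m-i,\ i-1,\ m-i}=\binom{n-i-1}{i-1}\binom{n-2i}{m-i}, \] and the number of $i$-dimensional faces without any boundedness constraint is at most \[ \frac{n-m}{n-i}\cdot\binom{n-1}{n-m,\ i-1,\ m-i}=\binom{n-i-1}{m-i}\binom{n-1}{i-1}. \] Furthermore, for any $1\le m<n$ there is an $m$-dimensional local tropical linear space in $\mathbb{R}^n$ that achieves all these bounds (i.e. both bounds, simultaneously for all $1\le i\le m$).
   Context: Notation: $[n]=\{1,\dots,n\}$; $\binom{[n]}{m}$ is the set of $m$-element subsets of $[n]$; $\mathbb{T}=\mathbb{R}\cup\{\infty\}$; $S\cup i$, $S-i$ mean $S\cup\{i\}$, $S\setminus\{i\}$. For integers with $a+b+c=N\ge 0$, $\binom{N}{a,\,b,\,c}=\frac{N!}{a!\,b!\,c!}$ is the multinomial coefficient, equal to $0$ if one of $a,b,c$ is negative; likewise $\binom{N}{k}=0$ if $N\ge 0$ and $k<0$ or $k>N$ (if $n-2i<0$ the product $\binom{n-i-1}{i-1}\binom{n-2i}{m-i}$ is $0$ since its first factor is). Tropical Plücker vector of rank $m$: a vector $p\in\mathbb{T}^{\binom{[n]}{m}}$, not identically $\infty$, such that for all $S,T\subseteq[n]$ with $|S|=m-1$, $|T|=m+1$, the minimum $\min_{i\in T\setminus S}(p_{S\cup i}+p_{T-i})$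 is achieved for at least two values of $i$ or equals $\infty$. Its support $\{A:p_A\ne\infty\}$ is the set of bases of a matroid $M$ on $[n]$, the underlying matroid of $p$. For $S\subseteq[n]$ with $|S|=m+1$ let $c_S\in\mathbb{T}^n$ be given by $(c_S)_i=p_{S-i}$ if $i\in S$, $\infty$ otherwise. The circuits of $p$ are the vectors $c_S+\lambda(1,\dots,1)$, $\lambda\in\mathbb{R}$, with $c_S\ne(\infty,\dots,\infty)$. Vectors $x,y\in\mathbb{T}^n$ are tropically orthogonal if $\min_i(x_i+y_i)$ is achieved at least twice or equals $\infty$. $L(p)\subseteq\mathbb{T}^n$ is the set of vectors tropically orthogonal to all circuits of $p$. For a basis $A$ of $M$ and $v\in\mathbb{R}^n$, let $w_p(v,A)=-p_A+\sum_{i\in A}v_i$. The bases of $M$ maximizing $w_p(v,\cdot)$ are the bases of a matroid $M_v$. For a basis $B$ of $M$, $\Sigma_B=\{v\in\mathbb{R}^n: B\text{ is a basis of }M_v\}$ and $L(p)_B=L(p)\cap\Sigma_B$. An $m$-dimensional local tropical linear space in $\mathbb{R}^n$ is a set $L(p)_B$ with $p\in\mathbb{T}^{\binom{[n]}{m}}$ a tropical Plücker vector of rank $m$ whose underlying matroid $M$ has no loops, and $B$ a basis of $M$. It is a polyhedral complex whose faces (cells) are the closures of the sets $\{v'\in L(p)_B: M_{v'}=M_v\}$, $v\in L(p)_B$. Every face is invariant under translation by $\mathbb{R}(1,\dots,1)$; a face "becomes bounded" if its image in $\mathbb{R}^n/\mathbb{R}(1,\dots,1)$ is bounded. Dimensions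 of faces are taken in $\mathbb{R}^n$, before modding out. *)

theory Defs
  imports "HOL-Analysis.Analysis"
begin

text \<open>
  The ground set of size \<open>n\<close> is a finite type \<open>'n\<close> with \<open>CARD('n) = n\<close>, and the tropical
  numbers (the reals together with \<open>\<infinity>\<close>) are the elements of \<^typ>\<open>ereal\<close> other than \<open>-\<infinity>\<close>.
\<close>

definition trop_vanishes :: "'a set \<Rightarrow> ('a \<Rightarrow> ereal) \<Rightarrow> bool" where
  "trop_vanishes I f \<longleftrightarrow>
     Min (f ` I) = \<infinity> \<or>
     (\<exists>i\<in>I. \<exists>j\<in>I. i \<noteq> j \<and> f i = Min (f ` I) \<and> f j = Min (f ` I))"

text \<open>
  A vector indexed by the \<open>m\<close>-element subsets is a function on all subsets of which only the
  values at \<open>m\<close>-element sets are ever used.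
\<close>

definition trop_plucker :: "nat \<Rightarrow> ('n::finite set \<Rightarrow> ereal) \<Rightarrow> bool" where
  "trop_plucker m p \<longleftrightarrow>
     (\<forall>A. card A = m \<longrightarrow> p A \<noteq> -\<infinity>) \<and>
     (\<exists>A. card A = m \<and> p A \<noteq> \<infinity>) \<and>
     (\<forall>S T. card S + 1 = m \<and> card T = m + 1 \<longrightarrow>
        trop_vanishes (T - S) (\<lambda>i. p (insert i S) + p (T - {i})))"

text \<open>Matroids are represented by their sets of bases.\<close>

definition bases :: "nat \<Rightarrow> ('n::finite set \<Rightarrow> ereal) \<Rightarrow> 'n set set" where
  "bases m p = {A. card A = m \<and> p A \<noteq> \<infinity>}"

definition is_loop :: "'n set set \<Rightarrow> 'n \<Rightarrow> bool" where
  "is_loop \<B> e \<longleftrightarrow> (\<forall>A\<in>\<B>. e \<notin> A)"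

definition trop_space :: "(ereal ^ 'n) set" where
  "trop_space = {x. \<forall>i. x $ i \<noteq> -\<infinity>}"

definition circuit_vec :: "('n::finite set \<Rightarrow> ereal) \<Rightarrow> 'n set \<Rightarrow> ereal ^ 'n" where
  "circuit_vec p S = (\<chi> i. if i \<in> S then p (S - {i}) else \<infinity>)"

definition circuits :: "nat \<Rightarrow> ('n::finite set \<Rightarrow> ereal) \<Rightarrow> (ereal ^ 'n) set" where
  "circuits m p =
     {(\<chi> i. circuit_vec p S $ i + ereal c) | S c.
        card S = m + 1 \<and> circuit_vec p S \<noteq> (\<chi> i. \<infinity>)}"

definition trop_orthogonal :: "ereal ^ 'n \<Rightarrow> ereal ^ 'n::finite \<Rightarrow> bool" where
  "trop_orthogonal x y \<longleftrightarrow> trop_vanishes UNIV (\<lambda>i. x $ i + y $ i)"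

definition trop_linear_space :: "nat \<Rightarrow> ('n::finite set \<Rightarrow> ereal) \<Rightarrow> (ereal ^ 'n) set" where
  "trop_linear_space m p = {x \<in> trop_space. \<forall>y\<in>circuits m p. trop_orthogonal x y}"

text \<open>Only meaningful at bases, where \<open>p A\<close> is a real number.\<close>

definition weight :: "('n::finite set \<Rightarrow> ereal) \<Rightarrow> real ^ 'n \<Rightarrow> 'n set \<Rightarrow> real" where
  "weight p v A = - real_of_ereal (p A) + (\<Sum>i\<in>A. v $ i)"

text \<open>The bases of the initial matroid \<open>M\<^sub>v\<close>.\<close>

definition initial_bases :: "nat \<Rightarrow> ('n::finite set \<Rightarrow> ereal) \<Rightarrow> real ^ 'n \<Rightarrow> 'n set set" where
  "initial_bases m p v = {A \<in> bases m p. \<forall>A'\<in>bases m p. weight p v A' \<le> weight p v A}"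

definition basis_region :: "nat \<Rightarrow> ('n::finite set \<Rightarrow> ereal) \<Rightarrow> 'n set \<Rightarrow> (real ^ 'n) set" where
  "basis_region m p B = {v. B \<in> initial_bases m p v}"

definition local_part :: "nat \<Rightarrow> ('n::finite set \<Rightarrow> ereal) \<Rightarrow> 'n set \<Rightarrow> (real ^ 'n) set" where
  "local_part m p B =
     {v. (\<chi> i. ereal (v $ i)) \<in> trop_linear_space m p} \<inter> basis_region m p B"

text \<open>
  The pair \<open>(p, B)\<close> presents the \<open>m\<close>-dimensional local tropical linear space
  \<open>local_part m p B\<close>; the cell structure below is defined in terms of this presentation.
\<close>

definition presents_local_tls :: "nat \<Rightarrow> ('n::finite set \<Rightarrow> ereal) \<Rightarrow> 'n set \<Rightarrow> bool" where
  "presents_local_tls m p B \<longleftrightarrow>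
     trop_plucker m p \<and> (\<forall>e. \<not> is_loop (bases m p) e) \<and> B \<in> bases m p"

definition faces :: "nat \<Rightarrow> ('n::finite set \<Rightarrow> ereal) \<Rightarrow> 'n set \<Rightarrow> (real ^ 'n) set set" where
  "faces m p B =
     {closure {v' \<in> local_part m p B. initial_bases m p v' = initial_bases m p v} | v.
        v \<in> local_part m p B}"

text \<open>
  Boundedness of the image in the quotient by the line spanned by \<open>(1, \<dots>, 1)\<close>: the quotient norm
  of the class of \<open>v\<close> is the distance from \<open>v\<close> to that line.
\<close>

definition bounded_mod_ones :: "(real ^ 'n::finite) set \<Rightarrow> bool" where
  "bounded_mod_ones F \<longleftrightarrow> (\<exists>K. \<forall>v\<in>F. infdist v (span {1}) \<le> K)"

definition num_faces :: "nat \<Rightarrow> ('n::finite set \<Rightarrow> ereal) \<Rightarrow> 'n set \<Rightarrow> nat \<Rightarrow> nat" where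
  "num_faces m p B i = card {F \<in> faces m p B. aff_dim F = int i}"

definition num_bounded_faces :: "nat \<Rightarrow> ('n::finite set \<Rightarrow> ereal) \<Rightarrow> 'n set \<Rightarrow> nat \<Rightarrow> nat" where
  "num_bounded_faces m p B i =
     card {F \<in> faces m p B. aff_dim F = int i \<and> bounded_mod_ones F}"

text \<open>There are only finitely many faces, so the cardinalities above are genuine counts.\<close>

lemma finite_faces: "finite (faces m p B)"
proof -
  have "faces m p B \<subseteq>
      (\<lambda>\<B>. closure {v' \<in> local_part m p B. initial_bases m p v' = \<B>}) ` UNIV"
    unfolding faces_def by blast
  then show ?thesis
    by (rule finite_subset) simp
qed

definition multinomial3 :: "nat \<Rightarrow> int \<Rightarrow> int \<Rightarrow> int \<Rightarrow> real" where
  "multinomial3 N a b c =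
     (if a < 0 \<or> b < 0 \<or> c < 0 then 0
      else fact N / (fact (nat a) * fact (nat b) * fact (nat c)))"

end

theory Submission
  imports Defs
begin

text \<open>
  Fix a basis \<open>B\<close> and put \<open>a\<^sub>b\<^sub>c = p (B - b + c) - p B\<close> for \<open>b \<in> B\<close> and \<open>c \<notin> B\<close>. By the exchange
  property, \<open>p A - p B\<close> is at least the weight of some perfect matching between \<open>B - A\<close> and \<open>A - B\<close>
  (\<open>matching_bound\<close>). Hence \<open>B\<close> has maximal weight as soon as \<open>v\<^sub>c - v\<^sub>b \<le> a\<^sub>b\<^sub>c\<close> for all \<open>b, c\<close>, the
  local tropical linear space is the set of \<open>v\<close> with \<open>v\<^sub>c = min\<^sub>b (v\<^sub>b + a\<^sub>b\<^sub>c)\<close> for all \<open>c \<notin> B\<close>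
  (\<open>local_part_eq_min_graph\<close>), and two of its points have the same initial matroid iff they have the same
  bipartite graph of tight edges (\<open>initial_bases_eq_iff\<close>). So faces are tight graphs \<open>G\<close>; the dimension
  of a face is the number of components of \<open>G\<close>, and in a bounded face no element of \<open>B\<close> is isolated. Only
  the matrix \<open>a\<close> matters.

  Perturbing \<open>a\<close> to a generic finite matrix embeds its tight graphs into those of the new matrix, preserving
  components and isolated vertices (\<open>embed_into_generic\<close>). It therefore suffices to count the tight graphs of
  generic matrices, and these numbers turn out to be the same for all of them. For generic \<open>a\<close> tight graphs are
  forests. Assign positive integral weights \<open>z\<close> to the edges of a tight graph. The potential shows that
  \<open>z\<close> is an optimal transport for its vertex degrees, so the degrees determine both \<open>z\<close> and its support
  (\<open>degrees_determine\<close>). Conversely, by linear programming duality and Hall's theorem, all nonnegative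
  integral degrees that are positive outside \<open>B\<close> and have equal totals on both sides occur
  (\<open>realize_degrees\<close>). Counting the weights with total \<open>M + 1\<close> in both ways gives, with \<open>m\<close> the
  cardinality of \<open>B\<close>,
  \<open>\<Sum>\<^sub>G (M choose |G| - 1) = (M + m choose m - 1) * (M choose n - m - 1)\<close>, and the same sum over the graphs
  without isolated vertices is \<open>(M choose m - 1) * (M choose n - m - 1)\<close>. Vandermonde's identity expands
  the right-hand sides in the linearly independent functions \<open>M choose j\<close>, and the coefficients are the face
  numbers (\<open>generic_graph_numbers\<close>).

  The bounds are attained for every generic matrix \<open>a\<close>, because the tropical maximal minors of \<open>[I | a]\<close> form
  a Pluecker vector whose matrix of exchange costs is \<open>a\<close> (\<open>exists_plucker_with_costs\<close>).
\<close>

section \<open>Valuated exchange and the region of a basis\<close>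


lemma card_exchange:
  fixes A :: "'n::finite set"
  assumes "j \<in> A" and "b \<notin> A"
  shows "card (insert b (A - {j})) = card A"
  using assms card.remove[of A j] by simp

text \<open>
  The relation for \<open>S = A - j\<close> and \<open>T = A' \<union> j\<close> contains the term \<open>p A + p A'\<close>, at the index
  \<open>j\<close>. It is finite, so the minimum is attained at two indices, and one of these is not \<open>j\<close>.
\<close>

lemma plucker_exchange:
  assumes pl: "trop_plucker m p" and A: "A \<in> bases m p" and A': "A' \<in> bases m p"
    and j: "j \<in> A - A'"
  obtains b where "b \<in> A' - A"
    "p (insert b (A - {j})) + p (insert j (A' - {b})) \<le> p A + p A'"
proof -
  define S where "S = A - {j}"
  define T where "T = insert j A'"
  define f where "f i = p (insert i S) + p (T - {i})" for i
  have cA: "card A = m" "card A' = m" and fin: "p A \<noteq> \<infinity>" "p A' \<noteq> \<infinity>"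
    using A A' by (auto simp: bases_def)
  have "card S + 1 = m"
    using j card.remove[of A j] by (simp add: S_def flip: cA(1))
  moreover have "card T = m + 1"
    using j cA(2) by (simp add: T_def)
  ultimately have "trop_vanishes (T - S) f"
    using pl unfolding trop_plucker_def f_def by blast
  moreover have jT: "j \<in> T - S" by (simp add: S_def T_def)
  moreover have fj: "f j = p A + p A'"
    using j by (simp add: f_def S_def T_def insert_absorb)
  moreover have le: "Min (f ` (T - S)) \<le> f j" using jT by (intro Min_le) auto
  moreover have "Min (f ` (T - S)) \<noteq> \<infinity>" using le fj fin by auto
  ultimately obtain b where b: "b \<in> T - S" "b \<noteq> j" "f b = Min (f ` (T - S))"
    unfolding trop_vanishes_def by metis
  show thesis
  proof
    show "b \<in> A' - A" using b by (auto simp: S_def T_def)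
    have "T - {b} = insert j (A' - {b})" using b by (auto simp: T_def)
    then show "p (insert b (A - {j})) + p (insert j (A' - {b})) \<le> p A + p A'"
      using le b(3) fj by (simp add: f_def S_def)
  qed
qed

lemma basis_exchange:
  assumes pl: "trop_plucker m p" and A: "A \<in> bases m p" and A': "A' \<in> bases m p"
    and j: "j \<in> A - A'"
  obtains b where "b \<in> A' - A" "insert b (A - {j}) \<in> bases m p" "insert j (A' - {b}) \<in> bases m p"
    "real_of_ereal (p (insert b (A - {j}))) + real_of_ereal (p (insert j (A' - {b})))
       \<le> real_of_ereal (p A) + real_of_ereal (p A')"
proof -
  obtain b where b: "b \<in> A' - A"
    and le: "p (insert b (A - {j})) + p (insert j (A' - {b})) \<le> p A + p A'"
    using plucker_exchange[OF assms] .
  have c: "card (insert b (A - {j})) = m" "card (insert j (A' - {b})) = m"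
    using A A' b j card_exchange[of j A b] card_exchange[of b A' j] by (auto simp: bases_def)
  have n: "\<And>D. card D = m \<Longrightarrow> p D \<noteq> -\<infinity>" using pl by (auto simp: trop_plucker_def)
  have f: "p A \<noteq> \<infinity>" "p A' \<noteq> \<infinity>" "card A = m" "card A' = m" using A A' by (auto simp: bases_def)
  have g: "p (insert b (A - {j})) \<noteq> \<infinity>" "p (insert j (A' - {b})) \<noteq> \<infinity>"
    using le f n[OF c(1)] n[OF c(2)] by auto
  show thesis
  proof (rule that[OF b])
    show "real_of_ereal (p (insert b (A - {j}))) + real_of_ereal (p (insert j (A' - {b})))
       \<le> real_of_ereal (p A) + real_of_ereal (p A')"
      using le f g n[OF f(3)] n[OF f(4)] n[OF c(1)] n[OF c(2)]
      by (cases "p A"; cases "p A'"; cases "p (insert b (A - {j}))"; cases "p (insert j (A' - {b}))") auto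
  qed (use c g in \<open>auto simp: bases_def\<close>)
qed

lemma weight_exchange:
  assumes pl: "trop_plucker m p" and A: "A \<in> bases m p" and A': "A' \<in> bases m p"
    and j: "j \<in> A - A'"
  obtains b where "b \<in> A' - A" "insert b (A - {j}) \<in> bases m p" "insert j (A' - {b}) \<in> bases m p"
    "weight p v A + weight p v A' \<le> weight p v (insert b (A - {j})) + weight p v (insert j (A' - {b}))"
proof -
  obtain b where b: "b \<in> A' - A" and B: "insert b (A - {j}) \<in> bases m p" "insert j (A' - {b}) \<in> bases m p"
    and le: "real_of_ereal (p (insert b (A - {j}))) + real_of_ereal (p (insert j (A' - {b})))
       \<le> real_of_ereal (p A) + real_of_ereal (p A')" by (rule basis_exchange[OF assms])
  show thesis
    by (rule that[OF b B])
      (use b j le in \<open>simp add: weight_def sum.insert_remove sum_diff1\<close>)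
qed

text \<open>
  Exchanging the elements of \<open>A - B\<close> against \<open>B\<close> one at a time pairs them with the elements of
  \<open>B - A\<close>, and every exchange costs at least as much as the single exchange in \<open>B\<close>. This makes the
  values of \<open>p\<close> at the neighbours of \<open>B\<close> control all its values.
\<close>

lemma matching_bound:
  assumes pl: "trop_plucker m p" and B: "B \<in> bases m p" and A: "A \<in> bases m p"
  shows "\<exists>\<sigma>. bij_betw \<sigma> (B - A) (A - B)
     \<and> (\<forall>b\<in>B - A. insert (\<sigma> b) (B - {b}) \<in> bases m p)
     \<and> (\<Sum>b\<in>B - A. real_of_ereal (p (insert (\<sigma> b) (B - {b}))) - real_of_ereal (p B))
         \<le> real_of_ereal (p A) - real_of_ereal (p B)"
  using A
proof (induction "card (A - B)" arbitrary: A)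
  case 0
  then have "A \<subseteq> B" by simp
  moreover have "card A = card B" using B 0 by (simp add: bases_def)
  ultimately have "A = B" by (metis card_subset_eq finite)
  then show ?case by (auto simp: bij_betw_def)
next
  case (Suc k)
  then have "A - B \<noteq> {}" by (metis card.empty nat.distinct(1))
  then obtain j where j: "j \<in> A - B" by blast
  obtain b where b: "b \<in> B - A" and A1: "insert b (A - {j}) \<in> bases m p"
    and B1: "insert j (B - {b}) \<in> bases m p"
    and le: "real_of_ereal (p (insert b (A - {j}))) + real_of_ereal (p (insert j (B - {b})))
       \<le> real_of_ereal (p A) + real_of_ereal (p B)"
    by (rule basis_exchange[OF pl Suc.prems B j])
  have AB: "insert b (A - {j}) - B = A - B - {j}" and BA: "B - insert b (A - {j}) = B - A - {b}"
    using b j by auto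
  have "k = card (insert b (A - {j}) - B)"
    using Suc.hyps(2) j AB by (simp add: card_Diff_singleton)
  from Suc.hyps(1)[OF this A1] obtain \<sigma> where
    bij: "bij_betw \<sigma> (B - A - {b}) (A - B - {j})"
    and bas: "\<forall>b'\<in>B - A - {b}. insert (\<sigma> b') (B - {b'}) \<in> bases m p"
    and le': "(\<Sum>b'\<in>B - A - {b}. real_of_ereal (p (insert (\<sigma> b') (B - {b'}))) - real_of_ereal (p B))
         \<le> real_of_ereal (p (insert b (A - {j}))) - real_of_ereal (p B)"
    unfolding AB BA by auto
  let ?\<tau> = "\<sigma>(b := j)"
  have "bij_betw ?\<tau> (B - A - {b}) (A - B - {j})"
    using bij by (rule bij_betw_cong[THEN iffD1, rotated]) simp
  moreover have "bij_betw ?\<tau> {b} {j}" by simp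
  ultimately have "bij_betw ?\<tau> ((B - A - {b}) \<union> {b}) ((A - B - {j}) \<union> {j})"
    by (rule bij_betw_combine) simp
  moreover have "(B - A - {b}) \<union> {b} = B - A" "(A - B - {j}) \<union> {j} = A - B" using b j by auto
  ultimately have "bij_betw ?\<tau> (B - A) (A - B)" by simp
  moreover have "\<forall>b'\<in>B - A. insert (?\<tau> b') (B - {b'}) \<in> bases m p" using bas B1 by auto
  moreover have "(\<Sum>b'\<in>B - A. real_of_ereal (p (insert (?\<tau> b') (B - {b'}))) - real_of_ereal (p B))
     = real_of_ereal (p (insert j (B - {b}))) - real_of_ereal (p B)
      + (\<Sum>b'\<in>B - A - {b}. real_of_ereal (p (insert (\<sigma> b') (B - {b'}))) - real_of_ereal (p B))"
    using b by (subst sum.remove[of _ b]) (auto intro!: sum.cong)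
  ultimately show ?case using le le' by (intro exI[of _ ?\<tau>]) auto
qed

text \<open>
  From here on, edges are pairs \<open>(b, c)\<close> with \<open>b \<in> B\<close> and \<open>c \<notin> B\<close>, and \<open>v\<close> is a potential on the
  vertices of the complete bipartite graph between \<open>B\<close> and its complement.
\<close>

definition gain :: "real ^ 'n \<Rightarrow> 'n \<times> 'n \<Rightarrow> real" where
  "gain v e = v $ snd e - v $ fst e"

definition feasible :: "'n set \<Rightarrow> ('n \<times> 'n \<Rightarrow> ereal) \<Rightarrow> real ^ 'n \<Rightarrow> bool" where
  "feasible B a v \<longleftrightarrow> (\<forall>e\<in>B \<times> -B. ereal (gain v e) \<le> a e)"

definition tight :: "'n set \<Rightarrow> ('n \<times> 'n \<Rightarrow> ereal) \<Rightarrow> real ^ 'n \<Rightarrow> ('n \<times> 'n) set" where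
  "tight B a v = {e \<in> B \<times> -B. ereal (gain v e) = a e}"

text \<open>
  In other words \<open>v\<^sub>c = min\<^sub>b (v\<^sub>b + a\<^sub>b\<^sub>c)\<close> for all \<open>c \<notin> B\<close>: this is the graph of a
  piecewise linear function of the coordinates in \<open>B\<close>.
\<close>

definition min_graph :: "'n set \<Rightarrow> ('n \<times> 'n \<Rightarrow> ereal) \<Rightarrow> (real ^ 'n) set" where
  "min_graph B a = {v. feasible B a v \<and> -B \<subseteq> snd ` tight B a v}"

definition exchange_cost :: "('n::finite set \<Rightarrow> ereal) \<Rightarrow> 'n set \<Rightarrow> 'n \<times> 'n \<Rightarrow> ereal" where
  "exchange_cost p B e = p (insert (snd e) (B - {fst e})) - p B"

lemma weight_swap:
  assumes pl: "trop_plucker m p" and B: "B \<in> bases m p" and e: "(b, c) \<in> B \<times> -B"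
  shows "insert c (B - {b}) \<in> bases m p \<Longrightarrow> exchange_cost p B (b, c)
           = ereal (gain v (b, c) + weight p v B - weight p v (insert c (B - {b})))"
    and "insert c (B - {b}) \<notin> bases m p \<Longrightarrow> exchange_cost p B (b, c) = \<infinity>"
proof -
  have c: "card (insert c (B - {b})) = m"
    using B e card_exchange[of b B c] by (auto simp: bases_def)
  have n: "\<And>D. card D = m \<Longrightarrow> p D \<noteq> -\<infinity>" using pl by (auto simp: trop_plucker_def)
  have f: "p B \<noteq> \<infinity>" "p B \<noteq> -\<infinity>" using B n by (auto simp: bases_def)
  have s: "(\<Sum>i\<in>insert c (B - {b}). v $ i) = (\<Sum>i\<in>B. v $ i) + gain v (b, c)"
    using e by (simp add: sum_diff1 gain_def)
  show "exchange_cost p B (b, c)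
           = ereal (gain v (b, c) + weight p v B - weight p v (insert c (B - {b})))"
    if "insert c (B - {b}) \<in> bases m p"
    using that f n[OF c] unfolding exchange_cost_def weight_def s
    by (cases "p B"; cases "p (insert c (B - {b}))") (auto simp: bases_def)
  show "exchange_cost p B (b, c) = \<infinity>" if "insert c (B - {b}) \<notin> bases m p"
    using that f n[OF c] c unfolding exchange_cost_def
    by (cases "p B") (auto simp: bases_def)
qed

lemma gain_le_exchange_cost_iff:
  assumes pl: "trop_plucker m p" and B: "B \<in> bases m p" and e: "(b, c) \<in> B \<times> -B"
  shows "ereal (gain v (b, c)) \<le> exchange_cost p B (b, c)
     \<longleftrightarrow> (insert c (B - {b}) \<in> bases m p \<longrightarrow> weight p v (insert c (B - {b})) \<le> weight p v B)"
    and "ereal (gain v (b, c)) = exchange_cost p B (b, c)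
     \<longleftrightarrow> (insert c (B - {b}) \<in> bases m p \<and> weight p v (insert c (B - {b})) = weight p v B)"
proof -
  have "exchange_cost p B (b, c) = (if insert c (B - {b}) \<in> bases m p
      then ereal (gain v (b, c) + weight p v B - weight p v (insert c (B - {b}))) else \<infinity>)"
    using weight_swap(1)[OF assms, of v] weight_swap(2)[OF assms] by auto
  then show "ereal (gain v (b, c)) \<le> exchange_cost p B (b, c)
     \<longleftrightarrow> (insert c (B - {b}) \<in> bases m p \<longrightarrow> weight p v (insert c (B - {b})) \<le> weight p v B)"
    and "ereal (gain v (b, c)) = exchange_cost p B (b, c)
     \<longleftrightarrow> (insert c (B - {b}) \<in> bases m p \<and> weight p v (insert c (B - {b})) = weight p v B)"
    by (auto split: if_splits)
qed

lemma sum_diff_matching: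
  fixes v :: "real ^ 'n::finite"
  assumes bij: "bij_betw \<sigma> (B - A) (A - B)"
  shows "(\<Sum>i\<in>A. v $ i) - (\<Sum>i\<in>B. v $ i) = (\<Sum>b\<in>B - A. gain v (b, \<sigma> b))"
proof -
  have "(\<Sum>i\<in>A. v $ i) - (\<Sum>i\<in>B. v $ i) = (\<Sum>i\<in>A - B. v $ i) - (\<Sum>i\<in>B - A. v $ i)"
    using sum.Int_Diff[of A "\<lambda>i. v $ i" B] sum.Int_Diff[of B "\<lambda>i. v $ i" A]
    by (simp add: Int_commute)
  also have "(\<Sum>i\<in>A - B. v $ i) = (\<Sum>b\<in>B - A. v $ \<sigma> b)"
    by (rule sum.reindex_bij_betw[OF bij, symmetric])
  finally show ?thesis by (simp add: gain_def sum_subtractf)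
qed

text \<open>
  Being a basis of maximal weight among the neighbours is enough: by the matching bound the weight lost in
  passing from \<open>B\<close> to \<open>A\<close> is at least the sum of the losses of the single exchanges along a matching,
  so it is nonnegative, and if it vanishes then every one of these exchanges is tight.
\<close>

lemma weight_le_of_feasible:
  assumes pl: "trop_plucker m p" and B: "B \<in> bases m p" and A: "A \<in> bases m p"
    and v: "feasible B (exchange_cost p B) v"
  obtains \<sigma> where "bij_betw \<sigma> (B - A) (A - B)" "weight p v A \<le> weight p v B"
    "weight p v A = weight p v B \<Longrightarrow> \<forall>b\<in>B - A. (b, \<sigma> b) \<in> tight B (exchange_cost p B) v"
proof -
  obtain \<sigma> where bij: "bij_betw \<sigma> (B - A) (A - B)"
    and bas: "\<forall>b\<in>B - A. insert (\<sigma> b) (B - {b}) \<in> bases m p"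
    and le: "(\<Sum>b\<in>B - A. real_of_ereal (p (insert (\<sigma> b) (B - {b}))) - real_of_ereal (p B))
         \<le> real_of_ereal (p A) - real_of_ereal (p B)"
    using matching_bound[OF pl B A] by blast
  define loss where "loss b = weight p v B - weight p v (insert (\<sigma> b) (B - {b}))" for b
  have mem: "(b, \<sigma> b) \<in> B \<times> -B" if "b \<in> B - A" for b using that bij by (auto simp: bij_betw_def)
  have loss: "loss b = real_of_ereal (p (insert (\<sigma> b) (B - {b}))) - real_of_ereal (p B) - gain v (b, \<sigma> b)"
    if "b \<in> B - A" for b
    using mem[OF that] by (simp add: loss_def weight_def sum_diff1 gain_def)
  have nonneg: "0 \<le> loss b" if "b \<in> B - A" for b
    using v mem[OF that] bas that gain_le_exchange_cost_iff(1)[OF pl B mem[OF that]]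
    by (fastforce simp: feasible_def loss_def)
  have sum_le: "(\<Sum>b\<in>B - A. loss b) \<le> weight p v B - weight p v A"
    using le sum_diff_matching[OF bij, of v]
    by (simp add: loss sum_subtractf weight_def)
  show thesis
  proof
    show "weight p v A \<le> weight p v B" using sum_le sum_nonneg[of "B - A" loss] nonneg by force
    show "\<forall>b\<in>B - A. (b, \<sigma> b) \<in> tight B (exchange_cost p B) v" if "weight p v A = weight p v B"
    proof
      fix b assume b: "b \<in> B - A"
      have "loss b = 0"
        using that sum_le nonneg b
        by (metis (no_types, lifting) cancel_comm_monoid_add_class.diff_cancel finite order_antisym sum_nonneg sum_nonneg_eq_0_iff)
      then show "(b, \<sigma> b) \<in> tight B (exchange_cost p B) v"
        using gain_le_exchange_cost_iff(2)[OF pl B mem[OF b]] mem[OF b] bas b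
        by (auto simp: tight_def loss_def)
    qed
  qed fact
qed

lemma mem_basis_region_iff:
  assumes pl: "trop_plucker m p" and B: "B \<in> bases m p"
  shows "v \<in> basis_region m p B \<longleftrightarrow> feasible B (exchange_cost p B) v"
proof
  assume "v \<in> basis_region m p B"
  then show "feasible B (exchange_cost p B) v"
    using gain_le_exchange_cost_iff(1)[OF pl B]
    by (auto simp: basis_region_def initial_bases_def feasible_def)
next
  assume "feasible B (exchange_cost p B) v"
  then show "v \<in> basis_region m p B"
    using weight_le_of_feasible[OF pl B] B by (auto simp: basis_region_def initial_bases_def)
qed

text \<open>
  The tight edges are the neighbours of \<open>B\<close> in the initial matroid. Conversely a basis \<open>A\<close> of the initial
  matroid of \<open>w\<close> is joined to \<open>B\<close> by a matching of tight edges. If these are tight for \<open>u\<close> too, then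
  \<open>u\<close> and \<open>w\<close> give \<open>A\<close> and \<open>B\<close> the same difference of weights, namely \<open>0\<close>.
\<close>

lemma initial_bases_eq_iff:
  assumes pl: "trop_plucker m p" and B: "B \<in> bases m p"
    and v: "feasible B (exchange_cost p B) v" and v': "feasible B (exchange_cost p B) v'"
  shows "initial_bases m p v = initial_bases m p v'
     \<longleftrightarrow> tight B (exchange_cost p B) v = tight B (exchange_cost p B) v'"
proof -
  have ini: "A \<in> initial_bases m p w \<longleftrightarrow> A \<in> bases m p \<and> weight p w A = weight p w B"
    if "feasible B (exchange_cost p B) w" for A w
    using weight_le_of_feasible[OF pl B _ that] B
    by (smt (verit) initial_bases_def mem_Collect_eq)
  have tig: "tight B (exchange_cost p B) w
     = {(b, c) \<in> B \<times> -B. insert c (B - {b}) \<in> initial_bases m p w}"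
    if "feasible B (exchange_cost p B) w" for w
    using gain_le_exchange_cost_iff(2)[OF pl B] by (auto simp: tight_def ini[OF that])
  have sub: "A \<in> initial_bases m p u"
    if t: "tight B (exchange_cost p B) w = tight B (exchange_cost p B) u"
      and w: "feasible B (exchange_cost p B) w" and u: "feasible B (exchange_cost p B) u"
      and A: "A \<in> initial_bases m p w" for w u A
  proof -
    have A': "A \<in> bases m p" "weight p w A = weight p w B" using A ini[OF w] by auto
    obtain \<sigma> where bij: "bij_betw \<sigma> (B - A) (A - B)"
      and T: "\<forall>b\<in>B - A. (b, \<sigma> b) \<in> tight B (exchange_cost p B) w"
      using weight_le_of_feasible[OF pl B A'(1) w] A'(2) by metis
    have "gain w (b, \<sigma> b) = gain u (b, \<sigma> b)" if "b \<in> B - A" for b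
    proof -
      have "(b, \<sigma> b) \<in> tight B (exchange_cost p B) w" "(b, \<sigma> b) \<in> tight B (exchange_cost p B) u"
        using T t that by auto
      then have "ereal (gain w (b, \<sigma> b)) = ereal (gain u (b, \<sigma> b))" by (simp add: tight_def)
      then show ?thesis by simp
    qed
    then have "(\<Sum>b\<in>B - A. gain w (b, \<sigma> b)) = (\<Sum>b\<in>B - A. gain u (b, \<sigma> b))"
      by (intro sum.cong) auto
    then have "weight p u A = weight p u B"
      using sum_diff_matching[OF bij, of w] sum_diff_matching[OF bij, of u] A'(2)
      by (simp add: weight_def)
    then show ?thesis using ini[OF u] A' by simp
  qed
  show ?thesis
  proof
    assume "initial_bases m p v = initial_bases m p v'"
    then show "tight B (exchange_cost p B) v = tight B (exchange_cost p B) v'"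
      by (simp only: tig[OF v] tig[OF v'])
  next
    assume t: "tight B (exchange_cost p B) v = tight B (exchange_cost p B) v'"
    show "initial_bases m p v = initial_bases m p v'"
      using sub[OF t v v'] sub[OF t[symmetric] v' v] by blast
  qed
qed

text \<open>
  Orthogonality to the circuit of \<open>B \<union> c\<close>, whose entry at \<open>c\<close> is the finite number \<open>p B\<close>, forces a
  second index \<open>b\<close> at which the minimum is attained; feasibility then makes \<open>(b, c)\<close> tight.
\<close>

lemma mem_local_partD:
  assumes pl: "trop_plucker m p" and B: "B \<in> bases m p" and v: "v \<in> local_part m p B"
  shows "v \<in> min_graph B (exchange_cost p B)"
proof -
  have feas: "feasible B (exchange_cost p B) v"
    using v mem_basis_region_iff[OF pl B] by (simp add: local_part_def)
  have "c \<in> snd ` tight B (exchange_cost p B) v" if c: "c \<in> -B" for c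
  proof -
    define f where "f i = ereal (v $ i) + circuit_vec p (insert c B) $ i" for i
    have pB: "p B \<noteq> \<infinity>" "card B = m" using B by (auto simp: bases_def)
    have cc: "circuit_vec p (insert c B) $ c = p B" using c by (simp add: circuit_vec_def)
    have "circuit_vec p (insert c B) \<noteq> (\<chi> i. \<infinity>)" using cc pB by (metis vec_lambda_beta)
    then have "(\<chi> i. circuit_vec p (insert c B) $ i + ereal 0) \<in> circuits m p"
      using c pB unfolding circuits_def mem_Collect_eq
      by (intro exI[of _ "insert c B"] exI[of _ "0::real"]) simp
    then have van: "trop_vanishes UNIV f"
      using v by (simp add: local_part_def trop_linear_space_def trop_orthogonal_def f_def[abs_def])
    have fc: "f c = v $ c + p B" using cc by (simp add: f_def)
    have le: "Min (range f) \<le> f c" by (intro Min_le) auto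
    then have "Min (range f) \<noteq> \<infinity>" using fc pB by auto
    then obtain b where b: "b \<noteq> c" "f b = Min (range f)"
      using van unfolding trop_vanishes_def by metis
    then have "f b \<noteq> \<infinity>" using \<open>Min (range f) \<noteq> \<infinity>\<close> by simp
    then have bB: "b \<in> B" using b(1) by (auto simp: f_def circuit_vec_def split: if_splits)
    have fb: "f b = v $ b + p (insert c (B - {b}))"
      using bB c by (auto simp: f_def circuit_vec_def insert_Diff_if)
    have mem: "(b, c) \<in> B \<times> -B" using bB c by simp
    have "v $ b + p (insert c (B - {b})) \<le> v $ c + p B" using le b(2) fb fc by simp
    then have "exchange_cost p B (b, c) \<le> ereal (gain v (b, c))"
      using pB pl unfolding exchange_cost_def gain_def trop_plucker_def
      by (cases "p B"; cases "p (insert c (B - {b}))") auto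
    then show ?thesis using feas mem by (force simp: feasible_def tight_def image_iff)
  qed
  then show ?thesis using feas by (auto simp: min_graph_def)
qed

text \<open>
  The initial matroid has no loops. If the minimum for the circuit of \<open>S\<close> is attained at \<open>i\<close>, exchange
  \<open>i\<close> out of an initial basis containing \<open>i\<close> and into \<open>S - i\<close>: since the initial basis cannot gain
  weight, some \<open>S - j\<close> is at least as heavy as \<open>S - i\<close>, which is a second index attaining the minimum.
\<close>

lemma mem_local_partI:
  assumes pl: "trop_plucker m p" and B: "B \<in> bases m p" and v: "v \<in> min_graph B (exchange_cost p B)"
  shows "v \<in> local_part m p B"
proof -
  have feas: "feasible B (exchange_cost p B) v" using v by (simp add: min_graph_def)
  then have reg: "v \<in> basis_region m p B" using mem_basis_region_iff[OF pl B] by simp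
  have no_loop: "\<exists>A\<in>initial_bases m p v. i \<in> A" for i
  proof (cases "i \<in> B")
    case True then show ?thesis using reg by (auto simp: basis_region_def)
  next
    case False
    then obtain b where t: "(b, i) \<in> tight B (exchange_cost p B) v"
      using v by (auto simp: min_graph_def)
    then have "insert i (B - {b}) \<in> bases m p" "weight p v (insert i (B - {b})) = weight p v B"
      using gain_le_exchange_cost_iff(2)[OF pl B] by (auto simp: tight_def)
    then have "insert i (B - {b}) \<in> initial_bases m p v"
      using reg by (auto simp: basis_region_def initial_bases_def)
    then show ?thesis by blast
  qed
  have "trop_vanishes UNIV (\<lambda>i. ereal (v $ i) + (circuit_vec p S $ i + ereal r))"
    if S: "card S = m + 1" and ne: "circuit_vec p S \<noteq> (\<chi> i. \<infinity>)" for S r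
  proof -
    define f where "f i = ereal (v $ i) + (circuit_vec p S $ i + ereal r)" for i
    obtain i where i: "f i = Min (range f)"
      by (metis (mono_tags, lifting) Min_in UNIV_not_empty finite finite_imageI image_iff image_is_empty)
    obtain k where k: "circuit_vec p S $ k \<noteq> \<infinity>" using ne by (auto simp: vec_eq_iff)
    have min: "f i \<le> f k" for k unfolding i by (intro Min_le) auto
    have "f k \<noteq> \<infinity>" using k by (simp add: f_def)
    then have fin: "f i \<noteq> \<infinity>" using min[of k] by auto
    then have iS: "i \<in> S" and pi: "p (S - {i}) \<noteq> \<infinity>" by (auto simp: f_def circuit_vec_def split: if_splits)
    then have A: "S - {i} \<in> bases m p" using S by (simp add: bases_def)
    obtain A' where A': "A' \<in> initial_bases m p v" "i \<in> A'" using no_loop by blast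
    have A'b: "A' \<in> bases m p" "i \<in> A' - (S - {i})" using A' by (auto simp: initial_bases_def)
    obtain j where j: "j \<in> S - {i} - A'" and b1: "insert j (A' - {i}) \<in> bases m p"
      and b2: "insert i (S - {i} - {j}) \<in> bases m p"
      and w: "weight p v A' + weight p v (S - {i})
         \<le> weight p v (insert j (A' - {i})) + weight p v (insert i (S - {i} - {j}))"
      by (rule weight_exchange[OF pl A'b(1) A A'b(2), of v])
    have eq: "insert i (S - {i} - {j}) = S - {j}" using iS j by auto
    have "weight p v (insert j (A' - {i})) \<le> weight p v A'" using A' b1 by (auto simp: initial_bases_def)
    then have w': "weight p v (S - {i}) \<le> weight p v (S - {j})" using w eq by simp
    have n: "p (S - {i}) \<noteq> -\<infinity>" "p (S - {j}) \<noteq> -\<infinity>"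
      using A b2 eq pl by (auto simp: bases_def trop_plucker_def)
    have pj: "p (S - {j}) \<noteq> \<infinity>" using b2 eq by (simp add: bases_def)
    have jS: "j \<in> S" "j \<noteq> i" using j by auto
    have "f j \<le> f i"
      using w' n pj pi iS jS
      by (cases "p (S - {i})"; cases "p (S - {j})")
         (auto simp: f_def circuit_vec_def weight_def sum_diff1)
    then have "f j = f i" using min[of j] by simp
    then have "trop_vanishes UNIV f" unfolding trop_vanishes_def using i jS by (metis UNIV_I)
    then show ?thesis by (simp add: f_def[abs_def])
  qed
  then have "(\<chi> i. ereal (v $ i)) \<in> trop_linear_space m p"
    by (auto simp: trop_linear_space_def trop_space_def circuits_def trop_orthogonal_def)
  then show ?thesis using reg by (simp add: local_part_def)
qed

lemma local_part_eq_min_graph: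
  assumes "trop_plucker m p" and "B \<in> bases m p"
  shows "local_part m p B = min_graph B (exchange_cost p B)"
  using mem_local_partD[OF assms] mem_local_partI[OF assms] by blast

section \<open>Faces as tight graphs\<close>


definition edge_vec :: "'n \<times> 'n \<Rightarrow> real ^ 'n::finite" where
  "edge_vec e = axis (snd e) 1 - axis (fst e) 1"

lemma gain_eq_inner: "gain v e = v \<bullet> edge_vec e"
  by (simp add: gain_def edge_vec_def inner_diff_right inner_axis)

lemma gain_add: "gain (v + w) e = gain v e + gain w e"
  and gain_diff: "gain (v - w) e = gain v e - gain w e"
  and gain_scale: "gain (r *\<^sub>R v) e = r * gain v e"
  by (simp_all add: gain_eq_inner inner_left_distrib inner_diff_left)

lemma continuous_on_gain [continuous_intros]:
  "continuous_on S f \<Longrightarrow> continuous_on S (\<lambda>x. gain (f x) e)"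
  unfolding gain_eq_inner by (intro continuous_intros)

text \<open>
  The dimension of this space is the number of connected components of the graph \<open>G\<close>.
\<close>

definition constant_along :: "('n \<times> 'n) set \<Rightarrow> (real ^ 'n::finite) set" where
  "constant_along G = {u. \<forall>e\<in>G. gain u e = 0}"

lemma subspace_constant_along: "subspace (constant_along G)"
  by (simp add: constant_along_def subspace_def gain_add gain_scale) (simp add: gain_def)

lemma dim_constant_along:
  "dim (constant_along G :: (real ^ 'n::finite) set) + dim (edge_vec ` G :: (real ^ 'n) set) = CARD('n)"
proof -
  have "constant_along G = {y :: real ^ 'n. \<forall>x\<in>span (edge_vec ` G). orthogonal x y}"
  proof (intro set_eqI iffI)
    fix y :: "real ^ 'n" assume y: "y \<in> constant_along G"
    have "orthogonal y x" if "x \<in> span (edge_vec ` G)" for x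
      using orthogonal_to_span[OF that, of y] y
      by (auto simp: constant_along_def orthogonal_def gain_eq_inner)
    then show "y \<in> {y. \<forall>x\<in>span (edge_vec ` G). orthogonal x y}"
      by (simp add: orthogonal_commute)
  next
    fix y :: "real ^ 'n" assume "y \<in> {y. \<forall>x\<in>span (edge_vec ` G). orthogonal x y}"
    then show "y \<in> constant_along G"
      by (auto simp: constant_along_def orthogonal_def gain_eq_inner span_base inner_commute)
  qed
  moreover have "dim {y \<in> UNIV :: (real ^ 'n) set. \<forall>x\<in>span (edge_vec ` G). orthogonal x y}
      + dim (span (edge_vec ` G) :: (real ^ 'n) set) = dim (UNIV :: (real ^ 'n) set)"
    by (intro dim_subspace_orthogonal_to_vectors) auto
  ultimately show ?thesis by (simp add: dim_span)
qed

text \<open>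
  The combinatorial types of the points of the local tropical linear space; each one is a face.
\<close>

definition tight_graphs :: "'n::finite set \<Rightarrow> ('n \<times> 'n \<Rightarrow> ereal) \<Rightarrow> ('n \<times> 'n) set set" where
  "tight_graphs B a = tight B a ` min_graph B a"

definition cell :: "'n::finite set \<Rightarrow> ('n \<times> 'n \<Rightarrow> ereal) \<Rightarrow> ('n \<times> 'n) set \<Rightarrow> (real ^ 'n) set" where
  "cell B a G = {v \<in> min_graph B a. tight B a v = G}"

lemma tight_graphs_subset: "G \<in> tight_graphs B a \<Longrightarrow> G \<subseteq> B \<times> -B"
  by (auto simp: tight_graphs_def tight_def)

lemma tight_graphs_cover: "G \<in> tight_graphs B a \<Longrightarrow> -B \<subseteq> snd ` G"
  by (auto simp: tight_graphs_def min_graph_def)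

lemma tight_graphs_cell: "G \<in> tight_graphs B a \<longleftrightarrow> cell B a G \<noteq> {}"
  by (auto simp: tight_graphs_def cell_def)

lemma mem_cell_iff:
  assumes "G \<subseteq> B \<times> -B" and "-B \<subseteq> snd ` G"
  shows "v \<in> cell B a G \<longleftrightarrow>
     (\<forall>e\<in>G. ereal (gain v e) = a e) \<and> (\<forall>e\<in>B \<times> -B - G. ereal (gain v e) < a e)" (is "_ \<longleftrightarrow> ?R")
proof
  assume "v \<in> cell B a G"
  then show ?R by (auto simp: cell_def min_graph_def feasible_def tight_def order.strict_iff_order)
next
  assume R: ?R
  have "e \<in> G" if "e \<in> tight B a v" for e
  proof (rule ccontr)
    assume "e \<notin> G"
    then have "ereal (gain v e) < a e" using that R unfolding tight_def by blast
    then show False using that by (simp add: tight_def)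
  qed
  moreover have "G \<subseteq> tight B a v" using R assms(1) unfolding tight_def by blast
  ultimately have "tight B a v = G" by blast
  moreover have "feasible B a v"
    unfolding feasible_def
  proof
    fix e assume "e \<in> B \<times> -B"
    then show "ereal (gain v e) \<le> a e" using R by (cases "e \<in> G") (auto intro: less_imp_le)
  qed
  ultimately show "v \<in> cell B a G" using assms(2) by (simp add: cell_def min_graph_def)
qed

lemma cell_eq_affine_Int_open:
  assumes v: "v \<in> cell B a G"
  shows "cell B a G = (+) v ` constant_along G
     \<inter> (\<Inter>e\<in>B \<times> -B - G. {w. ereal (gain w e) < a e})"
proof -
  have "G \<in> tight_graphs B a" using v by (auto simp: tight_graphs_def cell_def)
  note G = tight_graphs_subset[OF this] tight_graphs_cover[OF this]
  have tr: "w \<in> (+) v ` constant_along G \<longleftrightarrow> (\<forall>e\<in>G. gain w e = gain v e)" for w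
  proof -
    have "w \<in> (+) v ` constant_along G \<longleftrightarrow> w - v \<in> constant_along G"
      by (auto simp: image_iff intro!: bexI[of _ "w - v"])
    then show ?thesis by (simp add: constant_along_def gain_diff)
  qed
  have ve: "\<And>e. e \<in> G \<Longrightarrow> a e = ereal (gain v e)" using v unfolding mem_cell_iff[OF G] by simp
  show ?thesis unfolding set_eq_iff Int_iff tr mem_cell_iff[OF G] using ve by auto
qed

text \<open>
  A cell is a nonempty relatively open subset of a translate of \<open>constant_along G\<close>.
\<close>

lemma aff_dim_cell:
  fixes B :: "'n::finite set"
  assumes "G \<in> tight_graphs B a"
  shows "aff_dim (cell B a G) = int (dim (constant_along G :: (real ^ 'n) set))"
proof -
  obtain v where v: "v \<in> cell B a G" using assms tight_graphs_cell by blast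
  let ?U = "constant_along G :: (real ^ 'n) set"
  let ?O = "\<Inter>e\<in>B \<times> -B - G. {w :: real ^ 'n. ereal (gain w e) < a e}"
  have "open ?O"
  proof (intro open_INT ballI)
    show "open {w :: real ^ 'n. ereal (gain w e) < a e}" for e
      by (intro open_Collect_less continuous_intros)
  qed simp
  moreover have "convex ((+) v ` ?U)"
    using subspace_constant_along by (intro convex_translation subspace_imp_convex)
  moreover have "(+) v ` ?U \<inter> ?O \<noteq> {}" using v cell_eq_affine_Int_open[OF v] by blast
  ultimately have "aff_dim ((+) v ` ?U \<inter> ?O) = aff_dim ((+) v ` ?U)"
    by (intro aff_dim_convex_Int_open)
  also have "\<dots> = int (dim ?U)"
    by (simp add: aff_dim_translation_eq aff_dim_subspace subspace_constant_along)
  finally show ?thesis by (simp flip: cell_eq_affine_Int_open[OF v])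
qed

lemma closure_cell_gain:
  assumes "w \<in> closure (cell B a G)"
  shows "\<And>e. e \<in> G \<Longrightarrow> ereal (gain w e) = a e"
    and "\<And>e. e \<in> B \<times> -B \<Longrightarrow> ereal (gain w e) \<le> a e"
proof -
  have *: "cell B a G \<subseteq> S \<Longrightarrow> closed S \<Longrightarrow> w \<in> S" for S
    using assms closure_minimal by blast
  show "ereal (gain w e) = a e" if "e \<in> G" for e
  proof -
    have "closed {w. ereal (gain w e) = a e}"
      by (intro closed_Collect_eq continuous_intros)
    then show ?thesis using *[of "{w. ereal (gain w e) = a e}"] that
      by (auto simp: cell_def tight_def)
  qed
  show "ereal (gain w e) \<le> a e" if "e \<in> B \<times> -B" for e
  proof -
    have "closed {w. ereal (gain w e) \<le> a e}"
      by (intro closed_Collect_le continuous_intros)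
    then show ?thesis using *[of "{w. ereal (gain w e) \<le> a e}"] that
      by (auto simp: cell_def min_graph_def feasible_def)
  qed
qed

text \<open>
  \<open>G\<close> is recovered from the closed cell as the set of edges that are tight on all of it.
\<close>

lemma inj_on_closure_cell: "inj_on (\<lambda>G. closure (cell B a G)) (tight_graphs B a)"
proof (rule inj_on_inverseI)
  fix G assume G: "G \<in> tight_graphs B a"
  obtain v where v: "v \<in> cell B a G" using G tight_graphs_cell by blast
  then have "v \<in> closure (cell B a G)" using closure_subset by blast
  then show "{e \<in> B \<times> -B. \<forall>w\<in>closure (cell B a G). ereal (gain w e) = a e} = G"
    using v tight_graphs_subset[OF G] closure_cell_gain(1)
    unfolding cell_def tight_def by blast
qed

lemma faces_eq:
  assumes "presents_local_tls m p B"
  shows "faces m p B = (\<lambda>G. closure (cell B (exchange_cost p B) G)) ` tight_graphs B (exchange_cost p B)"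
proof -
  have pl: "trop_plucker m p" and B: "B \<in> bases m p" using assms by (auto simp: presents_local_tls_def)
  let ?a = "exchange_cost p B"
  have cell_eq: "{v' \<in> min_graph B ?a. initial_bases m p v' = initial_bases m p v} = cell B ?a (tight B ?a v)"
    if "v \<in> min_graph B ?a" for v
    using initial_bases_eq_iff[OF pl B] that by (auto simp: cell_def min_graph_def)
  show ?thesis
    unfolding faces_def local_part_eq_min_graph[OF pl B] tight_graphs_def image_image Setcompr_eq_image
    by (rule image_cong) (simp_all add: cell_eq)
qed

lemma num_faces_eq:
  fixes B :: "'n::finite set"
  assumes "presents_local_tls m p B"
  defines "a \<equiv> exchange_cost p B"
  shows "num_faces m p B i
      = card {G \<in> tight_graphs B a. dim (constant_along G :: (real ^ 'n) set) = i}"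
    and "num_bounded_faces m p B i
      = card {G \<in> tight_graphs B a. dim (constant_along G :: (real ^ 'n) set) = i
           \<and> bounded_mod_ones (closure (cell B a G))}"
proof -
  let ?F = "\<lambda>G. closure (cell B a G)"
  have *: "card {F \<in> faces m p B. aff_dim F = int i \<and> P F}
      = card {G \<in> tight_graphs B a. dim (constant_along G :: (real ^ 'n) set) = i \<and> P (?F G)}" for P
  proof -
    have "{F \<in> faces m p B. aff_dim F = int i \<and> P F}
       = ?F ` {G \<in> tight_graphs B a. dim (constant_along G :: (real ^ 'n) set) = i \<and> P (?F G)}"
      unfolding faces_eq[OF assms(1)] a_def[symmetric] by (auto simp: aff_dim_cell)
    then show ?thesis
      by (simp add: card_image inj_on_subset[OF inj_on_closure_cell])
  qed
  show "num_faces m p B i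
      = card {G \<in> tight_graphs B a. dim (constant_along G :: (real ^ 'n) set) = i}"
    using *[of "\<lambda>_. True"] by (simp add: num_faces_def)
  show "num_bounded_faces m p B i
      = card {G \<in> tight_graphs B a. dim (constant_along G :: (real ^ 'n) set) = i
           \<and> bounded_mod_ones (closure (cell B a G))}"
    using * by (simp add: num_bounded_faces_def)
qed

lemma abs_diff_le_infdist_ones:
  fixes v :: "real ^ 'n::finite"
  shows "\<bar>v $ i - v $ j\<bar> \<le> 2 * infdist v (span {1})"
proof -
  have ne: "span {1 :: real ^ 'n} \<noteq> {}" using span_zero by blast
  have "\<bar>v $ i - v $ j\<bar> / 2 \<le> infdist v (span {1})"
    unfolding infdist_notempty[OF ne]
  proof (rule cINF_greatest[OF ne])
    fix x :: "real ^ 'n" assume "x \<in> span {1}"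
    then obtain r where x: "x = r *\<^sub>R 1" by (auto simp: span_singleton)
    have "\<bar>v $ k - r\<bar> \<le> dist v x" for k
      using component_le_norm_cart[of "v - x" k] by (simp add: dist_norm x)
    from this[of i] this[of j] have "\<bar>v $ i - v $ j\<bar> \<le> 2 * dist v x" by linarith
    then show "\<bar>v $ i - v $ j\<bar> / 2 \<le> dist v x" by simp
  qed
  then show ?thesis by simp
qed

text \<open>
  If an element \<open>b \<in> B\<close> is isolated in \<open>G\<close>, the coordinate \<open>v\<^sub>b\<close> can be increased without bound inside
  the cell: this only loosens the inequalities at \<open>b\<close>.
\<close>

lemma bounded_imp_covers:
  assumes G: "G \<in> tight_graphs B a" and bd: "bounded_mod_ones (closure (cell B a G))" and ne: "-B \<noteq> {}"
  shows "B \<subseteq> fst ` G"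
proof
  fix b assume b: "b \<in> B"
  show "b \<in> fst ` G"
  proof (rule ccontr)
    assume nb: "b \<notin> fst ` G"
    obtain c where c: "c \<in> -B" using ne by blast
    obtain v where v: "v \<in> cell B a G" using G tight_graphs_cell by blast
    note Gs = tight_graphs_subset[OF G] tight_graphs_cover[OF G]
    note ci = mem_cell_iff[OF Gs]
    obtain K where K: "\<And>w. w \<in> closure (cell B a G) \<Longrightarrow> infdist w (span {1}) \<le> K"
      using bd by (auto simp: bounded_mod_ones_def)
    define t where "t = 1 + \<bar>v $ b - v $ c\<bar> + 2 * \<bar>K\<bar>"
    define w where "w = v + t *\<^sub>R axis b 1"
    have wi: "w $ i = v $ i + (if i = b then t else 0)" for i
      by (simp add: w_def axis_def)
    have same: "gain w e = gain v e" if "e \<in> G" for e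
      using that nb Gs(1) b by (cases e) (force simp: gain_def wi)
    have le: "gain w e \<le> gain v e" if "e \<in> B \<times> -B" for e
      using that b by (auto simp: gain_def wi t_def)
    have "w \<in> cell B a G"
      unfolding ci
    proof (intro conjI ballI)
      fix e assume "e \<in> G"
      then show "ereal (gain w e) = a e" using v ci same by metis
    next
      fix e assume e: "e \<in> B \<times> -B - G"
      then have "ereal (gain w e) \<le> ereal (gain v e)" using le by simp
      also have "\<dots> < a e" using v e unfolding ci by blast
      finally show "ereal (gain w e) < a e" .
    qed
    then have "w \<in> closure (cell B a G)" using closure_subset by blast
    from K[OF this] abs_diff_le_infdist_ones[of w b c] have "\<bar>w $ b - w $ c\<bar> \<le> 2 * K" by linarith
    moreover have "w $ b - w $ c = v $ b - v $ c + t" using b c by (auto simp: wi)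
    ultimately show False unfolding t_def by linarith
  qed
qed

text \<open>
  With finite costs, \<open>v\<^sub>c - v\<^sub>b\<close> is bounded above for all edges \<open>(b, c)\<close>, and equal to \<open>a\<^sub>b\<^sub>c\<close> along
  \<open>G\<close>. As every vertex lies on an edge of \<open>G\<close>, all differences of coordinates are bounded.
\<close>

lemma covers_imp_bounded:
  assumes G: "G \<in> tight_graphs B (\<lambda>e. ereal (a e))" and cov: "B \<subseteq> fst ` G"
  shows "bounded_mod_ones (closure (cell B (\<lambda>e. ereal (a e)) G))"
proof -
  let ?F = "closure (cell B (\<lambda>e. ereal (a e)) G)"
  have "\<exists>K. \<forall>w\<in>?F. w $ i - w $ j \<le> K" for i j
  proof -
    note Gs = tight_graphs_subset[OF G] tight_graphs_cover[OF G]
    have up: "\<exists>K b. b \<in> B \<and> (\<forall>w\<in>?F. w $ i - w $ b \<le> K)" for i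
    proof (cases "i \<in> B")
      case True then show ?thesis by (intro exI[of _ 0] exI[of _ i]) auto
    next
      case False
      then obtain b where bi: "(b, i) \<in> G" using Gs(2) by force
      have "\<forall>w\<in>?F. w $ i - w $ b \<le> a (b, i)"
        using closure_cell_gain(1)[OF _ bi] by (fastforce simp: gain_def)
      then show ?thesis using bi Gs(1) by blast
    qed
    obtain K b where b: "b \<in> B" and K: "\<forall>w\<in>?F. w $ i - w $ b \<le> K" using up by blast
    then obtain c where bc: "(b, c) \<in> G" using cov by force
    have c: "c \<in> -B" using bc Gs(1) by blast
    have E: "\<forall>w\<in>?F. w $ c - w $ b = a (b, c)"
      using closure_cell_gain(1)[OF _ bc] by (fastforce simp: gain_def)
    have down: "\<exists>K. \<forall>w\<in>?F. w $ c - w $ j \<le> K"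
    proof (cases "j \<in> B")
      case True
      have "\<forall>w\<in>?F. w $ c - w $ j \<le> a (j, c)"
        using closure_cell_gain(2)[where e="(j, c)"] True c by (fastforce simp: gain_def)
      then show ?thesis by blast
    next
      case False
      then obtain b' where bj: "(b', j) \<in> G" using Gs(2) by force
      have "\<forall>w\<in>?F. w $ j - w $ b' = a (b', j)"
        using closure_cell_gain(1)[OF _ bj] by (fastforce simp: gain_def)
      moreover have "\<forall>w\<in>?F. w $ c - w $ b' \<le> a (b', c)"
        using closure_cell_gain(2)[where e="(b', c)"] bj Gs(1) c by (fastforce simp: gain_def)
      ultimately have "\<forall>w\<in>?F. w $ c - w $ j \<le> a (b', c) - a (b', j)" by fastforce
      then show ?thesis by blast
    qed
    then obtain L where "\<forall>w\<in>?F. w $ c - w $ j \<le> L" by blast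
    with K E have "\<forall>w\<in>?F. w $ i - w $ j \<le> K - a (b, c) + L" by fastforce
    then show ?thesis by blast
  qed
  then obtain K where K: "\<And>i j w. w \<in> ?F \<Longrightarrow> w $ i - w $ j \<le> K i j" by metis
  obtain o' :: 'a where True by blast
  have "infdist w (span {1}) \<le> (\<Sum>i\<in>UNIV. \<bar>K i o'\<bar> + \<bar>K o' i\<bar>)" if w: "w \<in> ?F" for w
  proof -
    have "infdist w (span {1}) \<le> dist w (w $ o' *\<^sub>R 1)"
      by (intro infdist_le span_mul span_base) simp
    also have "\<dots> \<le> (\<Sum>i\<in>UNIV. \<bar>(w - w $ o' *\<^sub>R 1) $ i\<bar>)"
      unfolding dist_norm by (rule norm_le_l1_cart)
    also have "\<dots> \<le> (\<Sum>i\<in>UNIV. \<bar>K i o'\<bar> + \<bar>K o' i\<bar>)"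
    proof (rule sum_mono)
      fix i show "\<bar>(w - w $ o' *\<^sub>R 1) $ i\<bar> \<le> \<bar>K i o'\<bar> + \<bar>K o' i\<bar>"
        using K[OF w, of i o'] K[OF w, of o' i] by simp
    qed
    finally show ?thesis .
  qed
  then show ?thesis by (auto simp: bounded_mod_ones_def)
qed

section \<open>Generic costs\<close>


lemma tight_subset: "tight B a v \<subseteq> B \<times> -B"
  by (auto simp: tight_def)

lemma inj_on_edge_vec: "inj_on edge_vec (B \<times> -B)"
proof (rule inj_onI)
  fix e e' assume e: "e \<in> B \<times> -B" and e': "e' \<in> B \<times> -B"
    and eq: "(edge_vec e :: real ^ 'a) = edge_vec e'"
  have *: "(edge_vec f :: real ^ 'a) $ i = (if i = snd f then 1 else 0) - (if i = fst f then 1 else 0)" for f i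
    by (simp add: edge_vec_def axis_def)
  have ne: "fst e \<noteq> snd e" "fst e' \<noteq> snd e'" "fst e \<noteq> snd e'" "fst e' \<noteq> snd e"
    using e e' by auto
  have "(edge_vec e :: real ^ 'a) $ snd e = edge_vec e' $ snd e" "(edge_vec e :: real ^ 'a) $ fst e = edge_vec e' $ fst e"
    using eq by simp_all
  then show "e = e'" unfolding * using ne by (auto simp: prod_eq_iff split: if_splits)
qed

text \<open>
  Linear independence of the vectors \<open>e\<^sub>c - e\<^sub>b\<close> says that the tight graphs are forests.
\<close>

definition generic_costs :: "'n::finite set \<Rightarrow> ('n \<times> 'n \<Rightarrow> real) \<Rightarrow> bool" where
  "generic_costs B a \<longleftrightarrow> (\<forall>v. independent (edge_vec ` tight B (\<lambda>e. ereal (a e)) v :: (real ^ 'n) set))"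

lemma edge_relation:
  fixes D :: "('n::finite \<times> 'n) set"
  assumes "D \<subseteq> B \<times> -B" and "dependent (edge_vec ` D :: (real ^ 'n) set)"
  obtains l :: "real ^ ('n \<times> 'n)" where "l \<noteq> 0" "\<And>v :: real ^ 'n. (\<Sum>e\<in>D. l $ e * gain v e) = 0"
    "\<And>e. e \<notin> D \<Longrightarrow> l $ e = 0"
proof -
  have inj: "inj_on (edge_vec :: _ \<Rightarrow> real ^ 'n) D" using inj_on_edge_vec assms(1) by (rule inj_on_subset)
  obtain u where u: "\<exists>x\<in>edge_vec ` D. u x \<noteq> 0" "(\<Sum>x\<in>edge_vec ` D. u x *\<^sub>R x) = (0 :: real ^ 'n)"
    using assms(2) by (auto simp: dependent_finite)
  define l where "l = (\<chi> e. if e \<in> D then u (edge_vec e) else 0)"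
  have s: "(\<Sum>e\<in>D. l $ e *\<^sub>R edge_vec e) = (0 :: real ^ 'n)"
    using u(2) by (simp add: sum.reindex[OF inj] l_def)
  show thesis
  proof
    show "l \<noteq> 0" using u(1) by (auto simp: l_def vec_eq_iff)
    show "(\<Sum>e\<in>D. l $ e * gain v e) = 0" for v
      using arg_cong[OF s, of "\<lambda>x. v \<bullet> x"] by (simp add: inner_sum_right gain_eq_inner)
    show "l $ e = 0" if "e \<notin> D" for e using that by (simp add: l_def)
  qed
qed

text \<open>
  A graph with a linear relation \<open>\<Sum> l\<^sub>e (e\<^sub>c - e\<^sub>b) = 0\<close> can only be tight for costs with
  \<open>\<Sum> l\<^sub>e a\<^sub>e = 0\<close>. A direction \<open>\<delta>\<close> outside the finitely many hyperplanes obtained in this way crosses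
  each of them at most once.
\<close>

lemma generic_perturbation:
  fixes B :: "'n::finite set"
  obtains \<delta> :: "'n \<times> 'n \<Rightarrow> real" where "\<And>a. finite {\<epsilon>. \<not> generic_costs B (\<lambda>e. a e + \<epsilon> * \<delta> e)}"
proof -
  define \<D> where "\<D> = {D. D \<subseteq> B \<times> -B \<and> dependent (edge_vec ` D :: (real ^ 'n) set)}"
  have "\<forall>D\<in>\<D>. \<exists>l :: real ^ ('n \<times> 'n). l \<noteq> 0 \<and> (\<forall>v :: real ^ 'n. (\<Sum>e\<in>D. l $ e * gain v e) = 0)
      \<and> (\<forall>e. e \<notin> D \<longrightarrow> l $ e = 0)"
  proof
    fix D assume "D \<in> \<D>"
    then have "D \<subseteq> B \<times> -B" "dependent (edge_vec ` D :: (real ^ 'n) set)" by (auto simp: \<D>_def)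
    then obtain l :: "real ^ ('n \<times> 'n)" where "l \<noteq> 0" "\<And>v :: real ^ 'n. (\<Sum>e\<in>D. l $ e * gain v e) = 0"
      "\<And>e. e \<notin> D \<Longrightarrow> l $ e = 0" using edge_relation[of D B] by metis
    then show "\<exists>l :: real ^ ('n \<times> 'n). l \<noteq> 0 \<and> (\<forall>v :: real ^ 'n. (\<Sum>e\<in>D. l $ e * gain v e) = 0)
      \<and> (\<forall>e. e \<notin> D \<longrightarrow> l $ e = 0)" by blast
  qed
  then obtain l where l: "\<And>D. D \<in> \<D> \<Longrightarrow> l D \<noteq> 0"
    "\<And>D (v :: real ^ 'n). D \<in> \<D> \<Longrightarrow> (\<Sum>e\<in>D. l D $ e * gain v e) = 0"
    "\<And>D e. D \<in> \<D> \<Longrightarrow> e \<notin> D \<Longrightarrow> l D $ e = 0"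
    by metis
  have "negligible (\<Union>D\<in>\<D>. {x. l D \<bullet> x = 0})"
    using l(1) by (intro negligible_Union) (auto intro: negligible_hyperplane)
  then have "(\<Union>D\<in>\<D>. {x. l D \<bullet> x = 0}) \<noteq> UNIV" by (metis non_negligible_UNIV)
  then obtain x where x: "\<And>D. D \<in> \<D> \<Longrightarrow> l D \<bullet> x \<noteq> 0" by blast
  show thesis
  proof
    fix a :: "'n \<times> 'n \<Rightarrow> real"
    have "\<epsilon> \<in> (\<lambda>D. - (l D \<bullet> (\<chi> e. a e)) / (l D \<bullet> x)) ` \<D>"
      if ng: "\<not> generic_costs B (\<lambda>e. a e + \<epsilon> * x $ e)" for \<epsilon>
    proof -
      obtain v :: "real ^ 'n" where v: "dependent (edge_vec ` tight B (\<lambda>e. ereal (a e + \<epsilon> * x $ e)) v :: (real ^ 'n) set)"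
        using ng by (auto simp: generic_costs_def)
      define D where "D = tight B (\<lambda>e. ereal (a e + \<epsilon> * x $ e)) v"
      have D: "D \<in> \<D>" using v by (simp add: \<D>_def D_def tight_subset)
      have "0 = (\<Sum>e\<in>D. l D $ e * gain v e)" using l(2)[OF D] by simp
      also have "\<dots> = (\<Sum>e\<in>D. l D $ e * (a e + \<epsilon> * x $ e))"
        by (intro sum.cong) (auto simp: D_def tight_def)
      also have "\<dots> = (\<Sum>e\<in>UNIV. l D $ e * (a e + \<epsilon> * x $ e))"
        by (intro sum.mono_neutral_left) (auto simp: l(3)[OF D])
      also have "\<dots> = l D \<bullet> (\<chi> e. a e) + \<epsilon> * (l D \<bullet> x)"
        by (simp add: inner_vec_def sum.distrib sum_distrib_left algebra_simps)
      finally have "\<epsilon> = - (l D \<bullet> (\<chi> e. a e)) / (l D \<bullet> x)" using x[OF D] by (simp add: field_simps)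
      then show ?thesis using D by blast
    qed
    then have "{\<epsilon>. \<not> generic_costs B (\<lambda>e. a e + \<epsilon> * x $ e)}
        \<subseteq> (\<lambda>D. - (l D \<bullet> (\<chi> e. a e)) / (l D \<bullet> x)) ` \<D>" by blast
    then show "finite {\<epsilon>. \<not> generic_costs B (\<lambda>e. a e + \<epsilon> * x $ e)}"
      by (rule finite_subset) simp
  qed
qed

lemma exists_generic_costs: "\<exists>a. generic_costs B a"
proof -
  obtain \<delta> where \<delta>: "\<And>a. finite {\<epsilon>. \<not> generic_costs B (\<lambda>e. a e + \<epsilon> * \<delta> e)}"
    using generic_perturbation[of B] by blast
  obtain \<epsilon> where "\<epsilon> \<notin> {\<epsilon>. \<not> generic_costs B (\<lambda>e. 0 + \<epsilon> * \<delta> e)}"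
    using ex_new_if_finite[OF infinite_UNIV_char_0 \<delta>[of "\<lambda>_. 0"]] by blast
  then show ?thesis by blast
qed

text \<open>
  For generic costs, the dimension of a face is the number of vertices minus the number of edges.
\<close>

lemma generic_card:
  fixes B :: "'n::finite set"
  assumes "generic_costs B a" and "G \<in> tight_graphs B (\<lambda>e. ereal (a e))"
  shows "dim (constant_along G :: (real ^ 'n) set) + card G = CARD('n)"
proof -
  have ind: "independent (edge_vec ` G :: (real ^ 'n) set)"
    using assms by (auto simp: generic_costs_def tight_graphs_def)
  have "card (edge_vec ` G :: (real ^ 'n) set) = card G"
    using inj_on_edge_vec tight_graphs_subset[OF assms(2)] by (intro card_image) (rule inj_on_subset)
  then show ?thesis using dim_constant_along[of G] dim_eq_card_independent[OF ind] by simp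
qed

text \<open>
  The polyhedron of potentials with \<open>gain h e \<le> \<delta> e\<close> on \<open>G\<close> has the lineality space
  \<open>constant_along G\<close>, so a point with as many tight edges as possible lies on a minimal face and its
  tight edges span all components of \<open>G\<close>.
\<close>

lemma refine_tight:
  fixes \<delta> :: "'n::finite \<times> 'n \<Rightarrow> real" and h0 :: "real ^ 'n"
  assumes h0: "\<And>e. e \<in> G \<Longrightarrow> gain h0 e \<le> \<delta> e"
  obtains h :: "real ^ 'n" where "\<And>e. e \<in> G \<Longrightarrow> gain h e \<le> \<delta> e"
    "constant_along {e \<in> G. gain h e = \<delta> e} = (constant_along G :: (real ^ 'n) set)"
proof -
  define ok where "ok h \<longleftrightarrow> (\<forall>e\<in>G. gain h e \<le> \<delta> e)" for h :: "real ^ 'n"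
  define F where "F h = {e \<in> G. gain h e = \<delta> e}" for h :: "real ^ 'n"
  have "\<exists>h. ok h \<and> (\<forall>h'. ok h' \<longrightarrow> card (F h') \<le> card (F h))"
  proof (rule ex_has_greatest_nat)
    show "ok h0" using h0 by (simp add: ok_def)
    show "\<forall>h. ok h \<longrightarrow> card (F h) < Suc (card G)"
      by (auto simp: F_def less_Suc_eq_le intro: card_mono)
  qed
  then obtain h where h: "ok h" and max: "\<And>h'. ok h' \<Longrightarrow> card (F h') \<le> card (F h)" by blast
  have no_pos: "gain u e \<le> 0" if u: "u \<in> constant_along (F h)" and e: "e \<in> G" for u e
  proof (rule ccontr)
    assume pos: "\<not> gain u e \<le> 0"
    \<comment> \<open>Move in the direction \<open>u\<close> until the first edge of \<open>P\<close> becomes tight; no tight edge is lost.\<close>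
    define P where "P = {e \<in> G. gain u e > 0}"
    define r where "r e = (\<delta> e - gain h e) / gain u e" for e
    define t where "t = Min (r ` P)"
    have "e \<in> P" using pos e by (simp add: P_def)
    then have P: "finite P" "P \<noteq> {}" by auto
    have t0: "0 \<le> t" unfolding t_def using P h by (subst Min_ge_iff) (auto simp: P_def r_def ok_def)
    have "t \<in> r ` P" unfolding t_def using P by (intro Min_in) auto
    then obtain f where f: "f \<in> P" "t = r f" by blast
    have tle: "t \<le> r e" if "e \<in> P" for e unfolding t_def using P that by (intro Min_le) auto
    have "ok (h + t *\<^sub>R u)"
      unfolding ok_def
    proof
      fix e assume e: "e \<in> G"
      show "gain (h + t *\<^sub>R u) e \<le> \<delta> e"
      proof (cases "gain u e > 0")
        case True
        then show ?thesis using tle[of e] e by (simp add: P_def r_def gain_add gain_scale field_simps)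
      next
        case False
        then have "t * gain u e \<le> 0" using t0 by (simp add: mult_nonneg_nonpos)
        moreover have "gain h e \<le> \<delta> e" using h e by (simp add: ok_def)
        ultimately show ?thesis by (simp add: gain_add gain_scale)
      qed
    qed
    then have "card (F (h + t *\<^sub>R u)) \<le> card (F h)" by (rule max)
    moreover have "F h \<subseteq> F (h + t *\<^sub>R u)"
      using u by (auto simp: F_def constant_along_def gain_add gain_scale)
    moreover have "f \<in> F (h + t *\<^sub>R u)" using f by (simp add: F_def P_def r_def gain_add gain_scale)
    moreover have "f \<notin> F h" using u f(1) by (auto simp: P_def constant_along_def)
    ultimately show False by (metis card_seteq finite)
  qed
  have "constant_along (F h) = (constant_along G :: (real ^ 'n) set)"
  proof (intro equalityI subsetI)
    fix u :: "real ^ 'n" assume u: "u \<in> constant_along (F h)"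
    then have u': "-1 *\<^sub>R u \<in> constant_along (F h)" by (intro subspace_scale subspace_constant_along)
    show "u \<in> constant_along G"
      unfolding constant_along_def
    proof (intro CollectI ballI)
      fix e assume e: "e \<in> G"
      have "gain u e \<le> 0" "- gain u e \<le> 0" using no_pos[OF u e] no_pos[OF u' e] gain_scale[of "-1" u e] by simp_all
      then show "gain u e = 0" by simp
    qed
  qed (auto simp: constant_along_def F_def)
  then show thesis using that[of h] h by (simp add: ok_def F_def)
qed

text \<open>
  A vertex that \<open>F\<close> leaves isolated may vary freely in \<open>constant_along F\<close>, so \<open>G\<close> leaves it isolated.
\<close>

lemma constant_along_cover:
  assumes eq: "constant_along F = (constant_along G :: (real ^ 'n::finite) set)" and FG: "F \<subseteq> G" and G: "G \<subseteq> B \<times> -B"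
  shows "fst ` F = fst ` G" and "snd ` F = snd ` G"
proof -
  have "i \<in> fst ` F \<union> snd ` F" if mem: "i \<in> fst ` G \<union> snd ` G" for i
  proof (rule ccontr)
    assume i: "i \<notin> fst ` F \<union> snd ` F"
    have "fst e \<noteq> i" "snd e \<noteq> i" if "e \<in> F" for e using i that by auto
    then have "(axis i 1 :: real ^ 'n) \<in> constant_along F"
      by (simp add: constant_along_def gain_def axis_def)
    then have "(axis i 1 :: real ^ 'n) \<in> constant_along G" using eq by simp
    moreover obtain e where "e \<in> G" "i = fst e \<or> i = snd e" using mem by auto
    moreover have "fst e \<noteq> snd e" using G \<open>e \<in> G\<close> by auto
    ultimately show False by (auto simp: constant_along_def gain_def axis_def)
  qed
  then have "fst ` G \<union> snd ` G \<subseteq> fst ` F \<union> snd ` F" by (rule subsetI)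
  moreover have "fst ` G \<subseteq> B" "snd ` G \<subseteq> -B"
    by (rule image_subsetI, drule subsetD[OF G], simp add: mem_Times_iff)+
  moreover have "fst ` F \<subseteq> fst ` G" "snd ` F \<subseteq> snd ` G" using FG by auto
  moreover have "f' = f \<and> s' = s"
    if "f \<union> s \<subseteq> f' \<union> s'" "f \<subseteq> B" "s \<subseteq> -B" "f' \<subseteq> f" "s' \<subseteq> s" for f s f' s' :: "'n set"
    using that by blast
  ultimately show "fst ` F = fst ` G" "snd ` F = snd ` G" by simp_all
qed

lemma eventually_perturbed_less:
  fixes p q r s :: "'e \<Rightarrow> real"
  assumes "finite E" and "\<And>e. e \<in> E \<Longrightarrow> p e < q e"
  shows "\<forall>\<^sub>F \<epsilon> in at_right 0. \<forall>e\<in>E. p e + \<epsilon> * r e < q e + \<epsilon> * s e"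
proof (intro eventually_ball_finite ballI assms(1))
  fix e assume e: "e \<in> E"
  have "((\<lambda>\<epsilon>. q e + \<epsilon> * s e - (p e + \<epsilon> * r e))
      \<longlongrightarrow> q e + 0 * s e - (p e + 0 * r e)) (at_right 0)"
    by (intro tendsto_intros)
  then have "\<forall>\<^sub>F \<epsilon> in at_right 0. 0 < q e + \<epsilon> * s e - (p e + \<epsilon> * r e)"
    using assms(2)[OF e] by (intro order_tendstoD(1)) auto
  then show "\<forall>\<^sub>F \<epsilon> in at_right 0. p e + \<epsilon> * r e < q e + \<epsilon> * s e"
    by (rule eventually_mono) simp
qed

text \<open>
  Infinite costs are first replaced by a number exceeding all gains of finitely many representatives
  \<open>v\<^sub>G\<close>. A small step from \<open>v\<^sub>G\<close> then keeps all edges outside \<open>G\<close> slack, and inside \<open>G\<close> the direction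
  \<open>h\<^sub>G\<close> of the step decides which edges are tight for the perturbed costs.
\<close>

lemma perturbed_graphs:
  fixes a :: "'n::finite \<times> 'n \<Rightarrow> ereal" and \<delta> :: "'n \<times> 'n \<Rightarrow> real"
  obtains a0 :: "'n \<times> 'n \<Rightarrow> real" where
    "\<forall>\<^sub>F \<epsilon> in at_right 0. \<forall>G\<in>tight_graphs B a. \<exists>F\<in>tight_graphs B (\<lambda>e. ereal (a0 e + \<epsilon> * \<delta> e)).
       F \<subseteq> G \<and> constant_along F = (constant_along G :: (real ^ 'n) set)"
proof -
  have "\<forall>G\<in>tight_graphs B a. \<exists>v. v \<in> cell B a G" using tight_graphs_cell by blast
  then obtain v where v: "\<And>G. G \<in> tight_graphs B a \<Longrightarrow> v G \<in> cell B a G" by metis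
  have "\<exists>h :: real ^ 'n. (\<forall>e\<in>G. gain h e \<le> \<delta> e)
      \<and> constant_along {e \<in> G. gain h e = \<delta> e} = (constant_along G :: (real ^ 'n) set)"
    if G: "G \<in> tight_graphs B a" for G
  proof -
    define h0 :: "real ^ 'n" where "h0 = (\<chi> i. if i \<in> B then \<Sum>e\<in>UNIV. \<bar>\<delta> e\<bar> else 0)"
    have "gain h0 e \<le> \<delta> e" if "e \<in> G" for e
    proof -
      have "e \<in> B \<times> -B" using that tight_graphs_subset[OF G] by blast
      then have "gain h0 e = - (\<Sum>e\<in>UNIV. \<bar>\<delta> e\<bar>)" by (auto simp: gain_def h0_def)
      moreover have "\<bar>\<delta> e\<bar> \<le> (\<Sum>e\<in>UNIV. \<bar>\<delta> e\<bar>)" by (rule member_le_sum) auto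
      ultimately show ?thesis by linarith
    qed
    from refine_tight[OF this] show ?thesis by metis
  qed
  then obtain h :: "_ \<Rightarrow> real ^ 'n" where h: "\<And>G e. G \<in> tight_graphs B a \<Longrightarrow> e \<in> G \<Longrightarrow> gain (h G) e \<le> \<delta> e"
    and hc: "\<And>G. G \<in> tight_graphs B a \<Longrightarrow>
      constant_along {e \<in> G. gain (h G) e = \<delta> e} = (constant_along G :: (real ^ 'n) set)"
    by metis
  define a0 where "a0 e = (if a e = \<infinity> then 1 + (\<Sum>G\<in>UNIV. \<bar>gain (v G) e\<bar>) else real_of_ereal (a e))" for e
  have eqG: "gain (v G) e = a0 e" if "G \<in> tight_graphs B a" "e \<in> G" for G e
  proof -
    have "ereal (gain (v G) e) = a e" using v[OF that(1)] that(2) by (auto simp: cell_def tight_def)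
    then show ?thesis unfolding a0_def by (metis PInfty_neq_ereal(1) real_of_ereal.simps(1))
  qed
  have lt: "gain (v G) e < a0 e" if G: "G \<in> tight_graphs B a" and e: "e \<in> B \<times> -B - G" for G e
  proof (cases "a e = \<infinity>")
    case True
    have "\<bar>gain (v G) e\<bar> \<le> (\<Sum>G\<in>UNIV. \<bar>gain (v G) e\<bar>)" by (rule member_le_sum) auto
    then show ?thesis using True by (simp add: a0_def)
  next
    case False
    have "ereal (gain (v G) e) < a e"
      using v[OF G] e unfolding mem_cell_iff[OF tight_graphs_subset[OF G] tight_graphs_cover[OF G]] by blast
    then show ?thesis using False by (cases "a e") (auto simp: a0_def)
  qed
  have ev: "\<forall>\<^sub>F \<epsilon> in at_right 0. \<forall>G\<in>tight_graphs B a. \<forall>e\<in>B \<times> -B - G.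
      gain (v G) e + \<epsilon> * gain (h G) e < a0 e + \<epsilon> * \<delta> e"
    by (intro eventually_ball_finite ballI eventually_perturbed_less) (use lt in auto)
  show thesis
  proof
    show "\<forall>\<^sub>F \<epsilon> in at_right 0. \<forall>G\<in>tight_graphs B a. \<exists>F\<in>tight_graphs B (\<lambda>e. ereal (a0 e + \<epsilon> * \<delta> e)).
       F \<subseteq> G \<and> constant_along F = (constant_along G :: (real ^ 'n) set)"
      using ev eventually_at_right_less[of "0::real"]
    proof eventually_elim
      case (elim \<epsilon>)
      show ?case
      proof
        fix G assume G: "G \<in> tight_graphs B a"
        define F where "F = {e \<in> G. gain (h G) e = \<delta> e}"
        have FG: "F \<subseteq> G" by (auto simp: F_def)
        have eq: "constant_along F = (constant_along G :: (real ^ 'n) set)" using hc[OF G] by (simp add: F_def)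
        note GB = tight_graphs_subset[OF G]
        have F1: "F \<subseteq> B \<times> -B" using FG GB by blast
        have F2: "-B \<subseteq> snd ` F" using tight_graphs_cover[OF G] constant_along_cover(2)[OF eq FG GB] by simp
        have "v G + \<epsilon> *\<^sub>R h G \<in> cell B (\<lambda>e. ereal (a0 e + \<epsilon> * \<delta> e)) F"
          unfolding mem_cell_iff[OF F1 F2]
        proof (intro conjI ballI)
          fix e assume "e \<in> F"
          then show "ereal (gain (v G + \<epsilon> *\<^sub>R h G) e) = ereal (a0 e + \<epsilon> * \<delta> e)"
            using eqG[OF G] by (simp add: F_def gain_add gain_scale)
        next
          fix e assume e: "e \<in> B \<times> -B - F"
          have "gain (v G) e + \<epsilon> * gain (h G) e < a0 e + \<epsilon> * \<delta> e"
          proof (cases "e \<in> G")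
            case True
            then have "gain (h G) e < \<delta> e" using e h[OF G True] by (auto simp: F_def)
            then show ?thesis using elim(2) eqG[OF G True] by simp
          qed (use elim(1) G e in blast)
          then show "ereal (gain (v G + \<epsilon> *\<^sub>R h G) e) < ereal (a0 e + \<epsilon> * \<delta> e)"
            by (simp add: gain_add gain_scale)
        qed
        then have "F \<in> tight_graphs B (\<lambda>e. ereal (a0 e + \<epsilon> * \<delta> e))" using tight_graphs_cell by blast
        then show "\<exists>F\<in>tight_graphs B (\<lambda>e. ereal (a0 e + \<epsilon> * \<delta> e)).
           F \<subseteq> G \<and> constant_along F = (constant_along G :: (real ^ 'n) set)" using FG eq by blast
      qed
    qed
  qed
qed

text \<open>
  Two potentials that are tight on \<open>F\<close> differ by an element of \<open>constant_along F\<close>, so they agree in the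
  gain along every edge of \<open>G\<close>.
\<close>

lemma graph_determined_by_subgraph:
  fixes a :: "'n::finite \<times> 'n \<Rightarrow> ereal"
  assumes G: "G \<in> tight_graphs B a" and G': "G' \<in> tight_graphs B a" and F: "F \<subseteq> G \<inter> G'"
    and c: "constant_along F = (constant_along G :: (real ^ 'n) set)"
  shows "G \<subseteq> G'"
proof
  fix e assume e: "e \<in> G"
  obtain v v' where v: "v \<in> cell B a G" "v' \<in> cell B a G'" using G G' tight_graphs_cell by blast
  have "gain v f = gain v' f" if "f \<in> F" for f
  proof -
    have "ereal (gain v f) = a f" "ereal (gain v' f) = a f" using v that F by (auto simp: cell_def tight_def)
    then show ?thesis by (metis ereal.inject)
  qed
  then have "v - v' \<in> constant_along F" by (simp add: constant_along_def gain_diff)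
  then have "gain v e = gain v' e" using e unfolding c by (simp add: constant_along_def gain_diff)
  then show "e \<in> G'" using e v by (auto simp: cell_def tight_def)
qed

text \<open>
  This reduces the upper bounds to generic finite costs: every face is sent to a face of the same
  dimension, and graphs without isolated vertices are sent to such graphs.
\<close>

theorem embed_into_generic:
  fixes a :: "'n::finite \<times> 'n \<Rightarrow> ereal"
  obtains a' \<phi> where "generic_costs B a'" "inj_on \<phi> (tight_graphs B a)"
    "\<phi> ` tight_graphs B a \<subseteq> tight_graphs B (\<lambda>e. ereal (a' e))"
    "\<And>G. G \<in> tight_graphs B a \<Longrightarrow> constant_along (\<phi> G) = (constant_along G :: (real ^ 'n) set)"
    "\<And>G. G \<in> tight_graphs B a \<Longrightarrow> fst ` \<phi> G = fst ` G"
proof -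
  obtain \<delta> :: "'n \<times> 'n \<Rightarrow> real" where fin: "\<And>a. finite {\<epsilon>. \<not> generic_costs B (\<lambda>e. a e + \<epsilon> * \<delta> e)}"
    using generic_perturbation[of B] by blast
  obtain a0 where "\<forall>\<^sub>F \<epsilon> in at_right 0. \<forall>G\<in>tight_graphs B a. \<exists>F\<in>tight_graphs B (\<lambda>e. ereal (a0 e + \<epsilon> * \<delta> e)).
       F \<subseteq> G \<and> constant_along F = (constant_along G :: (real ^ 'n) set)"
    using perturbed_graphs .
  then obtain r where r: "r > 0" and P: "\<And>\<epsilon>. 0 < \<epsilon> \<Longrightarrow> \<epsilon> < r \<Longrightarrow>
      \<forall>G\<in>tight_graphs B a. \<exists>F\<in>tight_graphs B (\<lambda>e. ereal (a0 e + \<epsilon> * \<delta> e)).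
       F \<subseteq> G \<and> constant_along F = (constant_along G :: (real ^ 'n) set)"
    unfolding eventually_at_right_field by blast
  have "\<not> {0<..<r} \<subseteq> {\<epsilon>. \<not> generic_costs B (\<lambda>e. a0 e + \<epsilon> * \<delta> e)}"
    using finite_subset[OF _ fin[of a0]] infinite_Ioo[OF r] by blast
  then obtain \<epsilon> where \<epsilon>: "0 < \<epsilon>" "\<epsilon> < r" "generic_costs B (\<lambda>e. a0 e + \<epsilon> * \<delta> e)"
    by (auto simp only: subset_iff mem_Collect_eq greaterThanLessThan_iff)
  let ?a = "\<lambda>e. a0 e + \<epsilon> * \<delta> e"
  have "\<forall>G\<in>tight_graphs B a. \<exists>F. F \<in> tight_graphs B (\<lambda>e. ereal (?a e)) \<and>
       F \<subseteq> G \<and> constant_along F = (constant_along G :: (real ^ 'n) set)"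
    using P[OF \<epsilon>(1,2)] by blast
  from bchoice[OF this] obtain \<phi> where \<phi>: "\<And>G. G \<in> tight_graphs B a \<Longrightarrow> \<phi> G \<in> tight_graphs B (\<lambda>e. ereal (?a e))"
    "\<And>G. G \<in> tight_graphs B a \<Longrightarrow> \<phi> G \<subseteq> G"
    "\<And>G. G \<in> tight_graphs B a \<Longrightarrow> constant_along (\<phi> G) = (constant_along G :: (real ^ 'n) set)"
    by blast
  show thesis
  proof
    show "inj_on \<phi> (tight_graphs B a)"
    proof (rule inj_onI)
      fix G G' assume G: "G \<in> tight_graphs B a" "G' \<in> tight_graphs B a" and eq: "\<phi> G = \<phi> G'"
      have "\<phi> G \<subseteq> G \<inter> G'" using \<phi>(2)[OF G(1)] \<phi>(2)[OF G(2)] eq by simp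
      then show "G = G'"
        using graph_determined_by_subgraph[OF G] graph_determined_by_subgraph[OF G(2,1)]
          \<phi>(3)[OF G(1)] \<phi>(3)[OF G(2)] eq by (metis Int_commute subset_antisym)
    qed
    show "fst ` \<phi> G = fst ` G" if "G \<in> tight_graphs B a" for G
      using constant_along_cover(1)[OF \<phi>(3) \<phi>(2) tight_graphs_subset] that by blast
  qed (use \<epsilon> \<phi> in auto)
qed

section \<open>Potentials and integral transport\<close>


text \<open>
  Hall's marriage theorem with multiplicities: \<open>x b\<close> units of supply at \<open>b\<close>, a capacity of \<open>y c\<close> units at
  \<open>c\<close>. If some set of supplies exactly exhausts the capacity it can reach, the problem splits in two;
  otherwise one unit can be sent along an arbitrary usable edge without violating the condition.
\<close>

lemma transportation_hall:
  fixes x y :: "'n::finite \<Rightarrow> nat" and N :: "'n \<Rightarrow> 'n set"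
  assumes "\<And>S. S \<subseteq> B \<Longrightarrow> sum x S \<le> sum y (\<Union>b\<in>S. N b)"
  shows "\<exists>z :: 'n \<times> 'n \<Rightarrow> nat. (\<forall>b c. z (b, c) \<noteq> 0 \<longrightarrow> b \<in> B \<and> c \<in> N b)
      \<and> (\<forall>b\<in>B. (\<Sum>c\<in>UNIV. z (b, c)) = x b) \<and> (\<forall>c. (\<Sum>b\<in>UNIV. z (b, c)) \<le> y c)"
  using assms
proof (induction "sum x B" arbitrary: B x y rule: less_induct)
  case (less B x y)
  let ?N = "\<lambda>S. \<Union>b\<in>S. N b"
  show ?case
  proof (cases "\<exists>S\<subseteq>B. 0 < sum x S \<and> 0 < sum x (B - S) \<and> sum x S = sum y (?N S)")
    case True
    then obtain S where S: "S \<subseteq> B" "0 < sum x S" "0 < sum x (B - S)" "sum x S = sum y (?N S)" by blast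
    have split: "sum x B = sum x S + sum x (B - S)"
      using S(1) by (metis add.commute finite sum.subset_diff)
    have "\<exists>z :: 'n \<times> 'n \<Rightarrow> nat. (\<forall>b c. z (b, c) \<noteq> 0 \<longrightarrow> b \<in> S \<and> c \<in> N b)
      \<and> (\<forall>b\<in>S. (\<Sum>c\<in>UNIV. z (b, c)) = x b) \<and> (\<forall>c. (\<Sum>b\<in>UNIV. z (b, c)) \<le> y c)"
    proof (rule less.hyps)
      show "sum x S < sum x B" using split S by simp
      show "sum x T \<le> sum y (?N T)" if "T \<subseteq> S" for T using less.prems[of T] that S(1) by blast
    qed
    then obtain z1 :: "'n \<times> 'n \<Rightarrow> nat" where
      z1: "\<And>b c. z1 (b, c) \<noteq> 0 \<Longrightarrow> b \<in> S \<and> c \<in> N b" "\<And>b. b \<in> S \<Longrightarrow> (\<Sum>c\<in>UNIV. z1 (b, c)) = x b"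
        "\<And>c. (\<Sum>b\<in>UNIV. z1 (b, c)) \<le> y c" by blast
    define y' where "y' c = (if c \<in> ?N S then 0 else y c)" for c
    have "\<exists>z :: 'n \<times> 'n \<Rightarrow> nat. (\<forall>b c. z (b, c) \<noteq> 0 \<longrightarrow> b \<in> B - S \<and> c \<in> N b)
      \<and> (\<forall>b\<in>B - S. (\<Sum>c\<in>UNIV. z (b, c)) = x b) \<and> (\<forall>c. (\<Sum>b\<in>UNIV. z (b, c)) \<le> y' c)"
    proof (rule less.hyps)
      show "sum x (B - S) < sum x B" using split S by simp
      fix T assume T: "T \<subseteq> B - S"
      have "sum x T + sum x S = sum x (T \<union> S)" using T by (subst sum.union_disjoint) auto
      also have "\<dots> \<le> sum y (?N (T \<union> S))" using T S(1) by (intro less.prems) auto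
      also have "?N (T \<union> S) = (?N T - ?N S) \<union> ?N S" by auto
      also have "sum y \<dots> = sum y (?N T - ?N S) + sum y (?N S)" by (rule sum.union_disjoint) auto
      finally have "sum x T \<le> sum y (?N T - ?N S)" using S(4) by simp
      also have "\<dots> = sum y' (?N T - ?N S)" by (intro sum.cong) (auto simp: y'_def)
      also have "\<dots> \<le> sum y' (?N T)" by (intro sum_mono2) auto
      finally show "sum x T \<le> sum y' (?N T)" .
    qed
    then obtain z2 :: "'n \<times> 'n \<Rightarrow> nat" where
      z2: "\<And>b c. z2 (b, c) \<noteq> 0 \<Longrightarrow> b \<in> B - S \<and> c \<in> N b" "\<And>b. b \<in> B - S \<Longrightarrow> (\<Sum>c\<in>UNIV. z2 (b, c)) = x b"
        "\<And>c. (\<Sum>b\<in>UNIV. z2 (b, c)) \<le> y' c" by blast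
    show ?thesis
    proof (intro exI[of _ "\<lambda>e. z1 e + z2 e"] conjI allI ballI impI)
      fix b c assume "z1 (b, c) + z2 (b, c) \<noteq> 0"
      then have "z1 (b, c) \<noteq> 0 \<or> z2 (b, c) \<noteq> 0" by simp
      then show "b \<in> B" "c \<in> N b" using z1(1)[of b c] z2(1)[of b c] S(1) by auto
    next
      fix b assume b: "b \<in> B"
      show "(\<Sum>c\<in>UNIV. z1 (b, c) + z2 (b, c)) = x b"
      proof (cases "b \<in> S")
        case True
        then have "\<And>c. z2 (b, c) = 0" using z2(1) by blast
        then show ?thesis using z1(2)[OF True] by simp
      next
        case False
        then have "\<And>c. z1 (b, c) = 0" using z1(1) by blast
        then show ?thesis using z2(2)[of b] b False by simp
      qed
    next
      fix c
      show "(\<Sum>b\<in>UNIV. z1 (b, c) + z2 (b, c)) \<le> y c"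
      proof (cases "c \<in> ?N S")
        case True
        then show ?thesis using z1(3)[of c] z2(3)[of c] by (simp add: sum.distrib y'_def)
      next
        case False
        then have "\<And>b. z1 (b, c) = 0" using z1(1) by blast
        then show ?thesis using z2(3)[of c] False by (simp add: y'_def)
      qed
    qed
  next
    case no_tight: False
    show ?thesis
    proof (cases "sum x B = 0")
      case True
      then have "\<forall>b\<in>B. x b = 0" by simp
      then show ?thesis by (intro exI[of _ "\<lambda>_. 0"]) simp
    next
      case False
      then obtain b where b: "b \<in> B" "0 < x b" by (metis gr0I sum.neutral)
      have "0 < sum y (N b)" using less.prems[of "{b}"] b by simp
      then obtain c where c: "c \<in> N b" "0 < y c" by (metis gr0I sum.neutral less_irrefl)
      define x' where "x' = x(b := x b - 1)"
      define y' where "y' = y(c := y c - 1)"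
      have sx: "sum x S = sum x' S + (if b \<in> S then 1 else 0)" for S
      proof (cases "b \<in> S")
        case True
        then have "sum x S = x b + sum x (S - {b})" "sum x' S = x' b + sum x' (S - {b})"
          by (simp_all add: sum.remove)
        moreover have "sum x' (S - {b}) = sum x (S - {b})" by (intro sum.cong) (auto simp: x'_def)
        ultimately show ?thesis using True b(2) by (simp add: x'_def)
      next
        case False
        then show ?thesis by (auto simp: x'_def intro!: sum.cong)
      qed
      have sy: "sum y S = sum y' S + (if c \<in> S then 1 else 0)" for S
      proof (cases "c \<in> S")
        case True
        then have "sum y S = y c + sum y (S - {c})" "sum y' S = y' c + sum y' (S - {c})"
          by (simp_all add: sum.remove)
        moreover have "sum y' (S - {c}) = sum y (S - {c})" by (intro sum.cong) (auto simp: y'_def)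
        ultimately show ?thesis using True c(2) by (simp add: y'_def)
      next
        case False
        then show ?thesis by (auto simp: y'_def intro!: sum.cong)
      qed
      have "\<exists>z :: 'n \<times> 'n \<Rightarrow> nat. (\<forall>b c. z (b, c) \<noteq> 0 \<longrightarrow> b \<in> B \<and> c \<in> N b)
        \<and> (\<forall>b\<in>B. (\<Sum>c\<in>UNIV. z (b, c)) = x' b) \<and> (\<forall>c. (\<Sum>b\<in>UNIV. z (b, c)) \<le> y' c)"
      proof (rule less.hyps)
        show "sum x' B < sum x B" using sx[of B] b by simp
        fix S assume S: "S \<subseteq> B"
        have le: "sum x S \<le> sum y (?N S)" by (rule less.prems[OF S])
        show "sum x' S \<le> sum y' (?N S)"
        proof (cases "b \<in> S")
          case True
          then have "c \<in> ?N S" using c by blast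
          then show ?thesis using le sx[of S] sy[of "?N S"] True by simp
        next
          case bS: False
          show ?thesis
          proof (cases "c \<in> ?N S \<and> sum x S = sum y (?N S)")
            case True
            have "0 < sum x (B - S)" using b bS by (intro sum_pos2[of _ b]) simp_all
            moreover have "0 < sum y (?N S)" using True c by (intro sum_pos2[of _ c]) simp_all
            then have "0 < sum x S" using True by simp
            ultimately have False using no_tight S True by blast
            then show ?thesis ..
          next
            case False
            define U where "U = ?N S"
            show ?thesis using False le sx[of S] sy[of U] bS unfolding U_def[symmetric]
              by (auto split: if_splits)
          qed
        qed
      qed
      then obtain z :: "'n \<times> 'n \<Rightarrow> nat" where
        z: "\<And>b c. z (b, c) \<noteq> 0 \<Longrightarrow> b \<in> B \<and> c \<in> N b" "\<And>b. b \<in> B \<Longrightarrow> (\<Sum>c\<in>UNIV. z (b, c)) = x' b"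
          "\<And>c. (\<Sum>b\<in>UNIV. z (b, c)) \<le> y' c" by blast
      define w where "w e = z e + (if e = (b, c) then 1 else 0)" for e
      have rows: "(\<Sum>c'\<in>UNIV. w (b', c')) = (\<Sum>c'\<in>UNIV. z (b', c')) + (if b' = b then 1 else 0)" for b'
        by (auto simp: w_def sum.distrib)
      have cols: "(\<Sum>b'\<in>UNIV. w (b', c')) = (\<Sum>b'\<in>UNIV. z (b', c')) + (if c' = c then 1 else 0)" for c'
        by (auto simp: w_def sum.distrib)
      show ?thesis
      proof (intro exI[of _ w] conjI allI ballI impI)
        fix b' c' assume "w (b', c') \<noteq> 0"
        then have "z (b', c') \<noteq> 0 \<or> (b', c') = (b, c)" by (auto simp: w_def split: if_splits)
        then show "b' \<in> B" "c' \<in> N b'" using z(1)[of b' c'] b c by auto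
      next
        fix b' assume "b' \<in> B"
        then show "(\<Sum>c'\<in>UNIV. w (b', c')) = x b'"
          unfolding rows using z(2) b by (simp add: x'_def)
      next
        fix c' show "(\<Sum>b'\<in>UNIV. w (b', c')) \<le> y c'"
          unfolding cols using z(3)[of c'] c by (auto simp: y'_def split: if_splits)
      qed
    qed
  qed
qed


text \<open>
  Such a potential solves the dual of the transportation problem, that is, it maximizes
  \<open>\<Sum> y\<^sub>c v\<^sub>c - \<Sum> x\<^sub>b v\<^sub>b\<close>. If Hall's condition failed for \<open>S\<close>, lowering \<open>v\<close> on \<open>S\<close> and on the tight
  neighbours of \<open>S\<close> would keep \<open>v\<close> feasible and increase this function.
\<close>

lemma optimal_potential:
  fixes x y :: "'n::finite \<Rightarrow> nat" and a :: "'n \<times> 'n \<Rightarrow> real"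
  assumes disj: "P \<inter> Q = {}" and ne: "P \<noteq> {}" "Q \<noteq> {}"
    and xpos: "\<And>b. b \<in> P \<Longrightarrow> 0 < x b" and ypos: "\<And>c. c \<in> Q \<Longrightarrow> 0 < y c"
    and bal: "sum x P = sum y Q"
  obtains v :: "real ^ 'n" where "\<And>e. e \<in> P \<times> Q \<Longrightarrow> gain v e \<le> a e"
    "\<And>S. S \<subseteq> P \<Longrightarrow> sum x S \<le> sum y {c \<in> Q. \<exists>b\<in>S. gain v (b, c) = a (b, c)}"
proof -
  \<comment> \<open>The objective scaled by \<open>sum x P\<close> is a positive combination of the gains, so on the feasible set a lower bound for it bounds every gain from below.\<close>
  define wt where "wt e = real (x (fst e)) * real (y (snd e))" for e
  define obj where "obj v = (\<Sum>e\<in>P \<times> Q. wt e * gain v e)" for v :: "real ^ 'n"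
  have wpos: "0 < wt e" if "e \<in> P \<times> Q" for e using that xpos ypos by (auto simp: wt_def)
  obtain b0 c0 where b0: "b0 \<in> P" and c0: "c0 \<in> Q" using ne by blast
  define A where "A = (\<Sum>e\<in>UNIV. \<bar>a e\<bar>)"
  have A: "\<bar>a e\<bar> \<le> A" for e unfolding A_def by (rule member_le_sum) auto
  define v0 :: "real ^ 'n" where "v0 = (\<chi> i. if i \<in> Q then - A else 0)"
  \<comment> \<open>Normalizing \<open>v\<close> to vanish at \<open>b0\<close> leaves all gains unchanged and makes the superlevel set compact.\<close>
  define K where "K = {v :: real ^ 'n. (\<forall>i\<in>-(P \<union> Q). v $ i = 0) \<and> v $ b0 = 0
      \<and> (\<forall>e\<in>P \<times> Q. gain v e \<le> a e) \<and> obj v0 \<le> obj v}"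
  have v0: "v0 \<in> K"
    using disj b0 A by (auto simp: K_def v0_def gain_def abs_le_iff minus_le_iff)
  have "closed K"
    unfolding K_def obj_def Collect_conj_eq Ball_def
    by (intro closed_Int closed_Collect_all closed_Collect_imp open_Collect_const closed_Collect_eq closed_Collect_le
        continuous_intros)
  moreover have "bounded K"
  proof -
    define R where "R e = (obj v0 - (\<Sum>f\<in>P \<times> Q - {e}. wt f * a f)) / wt e" for e
    define M where "M = (\<Sum>e\<in>UNIV. \<bar>R e\<bar>) + A"
    have M: "\<bar>gain v e\<bar> \<le> M" if v: "v \<in> K" and e: "e \<in> P \<times> Q" for v e
    proof -
      have "obj v0 \<le> obj v" using v by (simp add: K_def)
      also have "obj v = wt e * gain v e + (\<Sum>f\<in>P \<times> Q - {e}. wt f * gain v f)"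
        unfolding obj_def using e by (intro sum.remove) auto
      also have "(\<Sum>f\<in>P \<times> Q - {e}. wt f * gain v f) \<le> (\<Sum>f\<in>P \<times> Q - {e}. wt f * a f)"
        using v wpos by (intro sum_mono mult_left_mono) (auto simp: K_def intro: less_imp_le)
      finally have "R e \<le> gain v e" using wpos[OF e] by (simp add: R_def field_simps)
      moreover have "gain v e \<le> a e" using v e unfolding K_def by blast
      moreover have "\<bar>R e\<bar> \<le> (\<Sum>e\<in>UNIV. \<bar>R e\<bar>)" by (rule member_le_sum) auto
      moreover have "\<bar>a e\<bar> \<le> A" by (rule A)
      ultimately show ?thesis unfolding M_def by linarith
    qed
    have M0: "0 \<le> M" using M[OF v0, of "(b0, c0)"] b0 c0 by simp
    have "\<bar>v $ i\<bar> \<le> 2 * M" if v: "v \<in> K" for v i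
    proof -
      have vb: "v $ b0 = 0" using v by (simp add: K_def)
      consider "i \<in> P" | "i \<in> Q" | "i \<in> -(P \<union> Q)" by blast
      then show ?thesis
      proof cases
        case 1
        then show ?thesis using M[OF v, of "(i, c0)"] M[OF v, of "(b0, c0)"] b0 c0 vb
          by (simp add: gain_def)
      next
        case 2
        then show ?thesis using M[OF v, of "(b0, i)"] b0 vb M0 by (simp add: gain_def)
      next
        case 3
        then show ?thesis using v M0 by (simp add: K_def)
      qed
    qed
    then have "\<forall>v\<in>K. norm v \<le> (\<Sum>i\<in>(UNIV :: 'n set). 2 * M)"
      by (intro ballI order.trans[OF norm_le_l1_cart] sum_mono)
    then show ?thesis unfolding bounded_iff by blast
  qed
  ultimately have "compact K" by (simp add: compact_eq_bounded_closed)
  moreover have "continuous_on K obj" unfolding obj_def by (intro continuous_intros)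
  ultimately obtain v where v: "v \<in> K" and max: "\<And>w. w \<in> K \<Longrightarrow> obj w \<le> obj v"
    using continuous_attains_sup[of K obj] v0 by blast
  have max': "obj w \<le> obj v" if w: "\<And>e. e \<in> P \<times> Q \<Longrightarrow> gain w e \<le> a e" for w
  proof (cases "obj v0 \<le> obj w")
    case True
    define w' where "w' = (\<chi> i. if i \<in> P \<union> Q then w $ i - w $ b0 else 0)"
    have g: "gain w' e = gain w e" if "e \<in> P \<times> Q" for e using that by (auto simp: w'_def gain_def)
    then have "obj w' = obj w" unfolding obj_def by (intro sum.cong) auto
    moreover have "w' \<in> K" using True w g b0 \<open>obj w' = obj w\<close> by (simp add: K_def w'_def)
    ultimately show ?thesis using max by metis
  next
    case False
    then show ?thesis using max[OF v0] by simp
  qed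
  show thesis
  proof
    show feas: "gain v e \<le> a e" if "e \<in> P \<times> Q" for e using v that unfolding K_def by blast
    fix S assume S: "S \<subseteq> P"
    define T where "T = {c \<in> Q. \<exists>b\<in>S. gain v (b, c) = a (b, c)}"
    show "sum x S \<le> sum y {c \<in> Q. \<exists>b\<in>S. gain v (b, c) = a (b, c)}"
      unfolding T_def[symmetric]
    proof (rule ccontr)
      assume viol: "\<not> sum x S \<le> sum y T"
      define u :: "real ^ 'n" where "u = (\<chi> i. if i \<in> S \<union> T then -1 else 0)"
      have gu: "gain u (b, c) = (if b \<in> S then 1 else 0) - (if c \<in> T then 1 else 0)"
        if "b \<in> P" "c \<in> Q" for b c
        using that S disj by (auto simp: gain_def u_def T_def)
      have "\<forall>\<^sub>F \<epsilon> in at_right 0. \<forall>e\<in>S \<times> (Q - T). gain v e + \<epsilon> * gain u e < a e + \<epsilon> * 0"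
      proof (intro eventually_perturbed_less)
        fix e assume e: "e \<in> S \<times> (Q - T)"
        then have "gain v e \<noteq> a e" by (auto simp: T_def)
        moreover have "gain v e \<le> a e" using e S by (intro feas) auto
        ultimately show "gain v e < a e" by simp
      qed simp
      then obtain r where r: "0 < r" "\<And>\<epsilon>. 0 < \<epsilon> \<Longrightarrow> \<epsilon> < r \<Longrightarrow> \<forall>e\<in>S \<times> (Q - T). gain v e + \<epsilon> * gain u e < a e + \<epsilon> * 0"
        unfolding eventually_at_right_field by blast
      define \<epsilon> where "\<epsilon> = r / 2"
      have \<epsilon>: "0 < \<epsilon>" "\<And>e. e \<in> S \<times> (Q - T) \<Longrightarrow> gain v e + \<epsilon> * gain u e < a e"
        using r(1) r(2)[of \<epsilon>] by (auto simp: \<epsilon>_def)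
      have "obj (v + \<epsilon> *\<^sub>R u) \<le> obj v"
      proof (rule max')
        fix e assume e: "e \<in> P \<times> Q"
        show "gain (v + \<epsilon> *\<^sub>R u) e \<le> a e"
        proof (cases "e \<in> S \<times> (Q - T)")
          case True
          then show ?thesis using \<epsilon>(2) by (simp add: gain_add gain_scale less_imp_le)
        next
          case False
          then have "gain u e \<le> 0" using e gu[of "fst e" "snd e"] by (auto simp: mem_Times_iff)
          then have "\<epsilon> * gain u e \<le> 0" using \<epsilon>(1) by (simp add: mult_nonneg_nonpos)
          then show ?thesis using feas[OF e] by (simp add: gain_add gain_scale)
        qed
      qed
      moreover have "obj (v + \<epsilon> *\<^sub>R u) = obj v + \<epsilon> * obj u"
        by (simp add: obj_def gain_add gain_scale sum.distrib sum_distrib_left algebra_simps)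
      moreover have "obj u = real (sum y Q) * real (sum x S) - real (sum x P) * real (sum y T)"
      proof -
        have "obj u = (\<Sum>(b, c)\<in>P \<times> Q. real (x b) * real (y c) * ((if b \<in> S then 1 else 0) - (if c \<in> T then 1 else 0)))"
          unfolding obj_def by (intro sum.cong) (auto simp: wt_def gu)
        also have "\<dots> = (\<Sum>b\<in>P. \<Sum>c\<in>Q. real (x b) * real (y c) * ((if b \<in> S then 1 else 0) - (if c \<in> T then 1 else 0)))"
          by (rule sum.cartesian_product[symmetric])
        also have "\<dots> = (\<Sum>b\<in>P. \<Sum>c\<in>Q. (if b \<in> S then real (x b) else 0) * real (y c)
            - real (x b) * (if c \<in> T then real (y c) else 0))"
          by (intro sum.cong refl) simp
        also have "\<dots> = (\<Sum>b\<in>P. \<Sum>c\<in>Q. (if b \<in> S then real (x b) else 0) * real (y c))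
            - (\<Sum>b\<in>P. \<Sum>c\<in>Q. real (x b) * (if c \<in> T then real (y c) else 0))"
          by (simp only: sum_subtractf)
        also have "\<dots> = (\<Sum>b\<in>P. if b \<in> S then real (x b) else 0) * (\<Sum>c\<in>Q. real (y c))
            - (\<Sum>b\<in>P. real (x b)) * (\<Sum>c\<in>Q. if c \<in> T then real (y c) else 0)"
          by (simp only: sum_product)
        also have "(\<Sum>b\<in>P. if b \<in> S then real (x b) else 0) = real (sum x S)"
          using S by (simp add: sum.If_cases Int_absorb1)
        also have "(\<Sum>c\<in>Q. if c \<in> T then real (y c) else 0) = real (sum y T)"
        proof -
          have "Q \<inter> T = T" by (auto simp: T_def)
          then show ?thesis by (simp add: sum.If_cases)
        qed
        finally show ?thesis by simp
      qed
      moreover have "0 < real (sum x P)" using ne(1) xpos by (simp add: sum_pos)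
      ultimately have "\<epsilon> * (real (sum x P) * (real (sum x S) - real (sum y T))) \<le> 0"
        using bal by (simp add: algebra_simps)
      moreover have "0 < \<epsilon> * (real (sum x P) * (real (sum x S) - real (sum y T)))"
      proof (intro mult_pos_pos \<epsilon>(1) \<open>0 < real (sum x P)\<close>)
        show "0 < real (sum x S) - real (sum y T)" using viol by linarith
      qed
      ultimately show False by simp
    qed
  qed
qed

lemma gain_interpolation:
  fixes f :: "'n::finite \<times> 'n \<Rightarrow> real"
  assumes "T \<subseteq> B \<times> -B" and ind: "independent (edge_vec ` T :: (real ^ 'n) set)"
  obtains u :: "real ^ 'n" where "\<And>e. e \<in> T \<Longrightarrow> gain u e = f e"
proof -
  have inj: "inj_on (edge_vec :: _ \<Rightarrow> real ^ 'n) T" using inj_on_edge_vec assms(1) by (rule inj_on_subset)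
  obtain g :: "real ^ 'n \<Rightarrow> real" where g: "linear g"
    "\<forall>x\<in>edge_vec ` T. g x = f (inv_into T edge_vec x)"
    using linear_independent_extend[OF ind, of "\<lambda>x. f (inv_into T edge_vec x)"] by metis
  show thesis
  proof
    fix e assume e: "e \<in> T"
    have "gain (adjoint g 1) e = edge_vec e \<bullet> adjoint g 1"
      by (simp add: gain_eq_inner inner_commute)
    also have "\<dots> = g (edge_vec e)" using adjoint_works[OF g(1), of "edge_vec e" 1] by simp
    also have "\<dots> = f e" using g(2) e inj by simp
    finally show "gain (adjoint g 1) e = f e" .
  qed
qed

section \<open>Degree vectors of generic tight graphs\<close>


definition row_sums :: "('n::finite \<times> 'n \<Rightarrow> nat) \<Rightarrow> 'n \<Rightarrow> nat" where
  "row_sums z b = (\<Sum>c\<in>UNIV. z (b, c))"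

definition col_sums :: "('n::finite \<times> 'n \<Rightarrow> nat) \<Rightarrow> 'n \<Rightarrow> nat" where
  "col_sums z c = (\<Sum>b\<in>UNIV. z (b, c))"

definition supp :: "('e \<Rightarrow> nat) \<Rightarrow> 'e set" where
  "supp f = {e. f e \<noteq> 0}"

lemma supp_row_sums: "supp (row_sums z) = fst ` supp z"
  by (force simp: supp_def row_sums_def)

lemma supp_col_sums: "supp (col_sums z) = snd ` supp z"
  by (force simp: supp_def col_sums_def)

lemma sum_row_sums: "sum (row_sums z) UNIV = sum z UNIV"
  and sum_col_sums: "sum (col_sums z) UNIV = sum z UNIV"
proof -
  show "sum (row_sums z) UNIV = sum z UNIV"
    by (simp add: row_sums_def sum.cartesian_product flip: UNIV_Times_UNIV)
  then show "sum (col_sums z) UNIV = sum z UNIV"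
    unfolding row_sums_def col_sums_def by (subst sum.swap) simp
qed

lemma sum_supp: "supp f \<subseteq> A \<Longrightarrow> finite A \<Longrightarrow> sum f A = sum f (supp f)"
  by (intro sum.mono_neutral_right) (auto simp: supp_def)

text \<open>
  Summation by parts: only the degrees of \<open>z\<close> enter the total gain.
\<close>

lemma weighted_gain:
  "(\<Sum>e\<in>UNIV. real (z e) * gain w e)
     = (\<Sum>c\<in>UNIV. real (col_sums z c) * w $ c) - (\<Sum>b\<in>UNIV. real (row_sums z b) * w $ b)"
proof -
  have "(\<Sum>e\<in>UNIV. real (z e) * gain w e)
      = (\<Sum>b\<in>UNIV. \<Sum>c\<in>UNIV. real (z (b, c)) * w $ c - real (z (b, c)) * w $ b)"
    unfolding UNIV_Times_UNIV[symmetric] sum.cartesian_product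
    by (intro sum.cong) (auto simp: gain_def algebra_simps)
  also have "\<dots> = (\<Sum>b\<in>UNIV. \<Sum>c\<in>UNIV. real (z (b, c)) * w $ c) - (\<Sum>b\<in>UNIV. \<Sum>c\<in>UNIV. real (z (b, c)) * w $ b)"
    by (simp only: sum_subtractf)
  also have "(\<Sum>b\<in>UNIV. \<Sum>c\<in>UNIV. real (z (b, c)) * w $ c) = (\<Sum>c\<in>UNIV. \<Sum>b\<in>UNIV. real (z (b, c)) * w $ c)"
    by (rule sum.swap)
  finally show ?thesis by (simp add: row_sums_def col_sums_def sum_distrib_right)
qed

text \<open>
  An optimal potential and Hall's theorem give an integral transport \<open>z\<close> supported on tight edges. The tight
  edges are independent, so a small change of the potential loosens exactly those that \<open>z\<close> does not use.
\<close>

lemma realize_degrees: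
  fixes B :: "'n::finite set" and x y :: "'n \<Rightarrow> nat"
  assumes gen: "generic_costs B a" and ne: "-B \<noteq> {}"
    and x: "supp x \<subseteq> B" and y: "supp y = -B" and bal: "sum x B = sum y (-B)"
  obtains z where "supp z \<in> tight_graphs B (\<lambda>e. ereal (a e))" "row_sums z = x" "col_sums z = y"
proof -
  define P where "P = supp x"
  define Q where "Q = -B"
  have PB: "P \<subseteq> B" using x by (simp add: P_def)
  have ypos: "0 < y c" if "c \<in> Q" for c using that y by (auto simp: Q_def supp_def)
  have "0 < sum y Q" using ne ypos by (intro sum_pos) (auto simp: Q_def)
  have sx: "sum x P = sum y Q" using bal sum_supp[OF x] by (simp add: P_def Q_def)
  have "P \<noteq> {}" using sx \<open>0 < sum y Q\<close> by auto
  obtain v :: "real ^ 'n" where v: "\<And>e. e \<in> P \<times> Q \<Longrightarrow> gain v e \<le> a e"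
    and hall: "\<And>S. S \<subseteq> P \<Longrightarrow> sum x S \<le> sum y {c \<in> Q. \<exists>b\<in>S. gain v (b, c) = a (b, c)}"
  proof (rule optimal_potential[of P Q x y a])
    show "P \<inter> Q = {}" using PB by (auto simp: Q_def)
    show "Q \<noteq> {}" using ne by (simp add: Q_def)
    show "0 < x b" if "b \<in> P" for b using that by (simp add: P_def supp_def)
  qed (use \<open>P \<noteq> {}\<close> ypos sx in auto)
  define N where "N b = {c \<in> Q. gain v (b, c) = a (b, c)}" for b
  have "\<exists>z :: 'n \<times> 'n \<Rightarrow> nat. (\<forall>b c. z (b, c) \<noteq> 0 \<longrightarrow> b \<in> P \<and> c \<in> N b)
      \<and> (\<forall>b\<in>P. (\<Sum>c\<in>UNIV. z (b, c)) = x b) \<and> (\<forall>c. (\<Sum>b\<in>UNIV. z (b, c)) \<le> y c)"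
  proof (rule transportation_hall)
    fix S assume S: "S \<subseteq> P"
    have "(\<Union>b\<in>S. N b) = {c \<in> Q. \<exists>b\<in>S. gain v (b, c) = a (b, c)}" by (auto simp: N_def)
    then show "sum x S \<le> sum y (\<Union>b\<in>S. N b)" using hall[OF S] by simp
  qed
  then obtain z :: "'n \<times> 'n \<Rightarrow> nat" where z: "\<And>b c. z (b, c) \<noteq> 0 \<Longrightarrow> b \<in> P \<and> c \<in> N b"
    and rows: "\<And>b. b \<in> P \<Longrightarrow> row_sums z b = x b" and cols: "\<And>c. col_sums z c \<le> y c"
    unfolding row_sums_def col_sums_def by blast
  have row: "row_sums z = x"
  proof
    fix b show "row_sums z b = x b"
    proof (cases "b \<in> P")
      case False
      then have "z (b, c) = 0" for c using z by blast
      then show ?thesis using False by (simp add: row_sums_def P_def supp_def)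
    qed (rule rows)
  qed
  have col: "col_sums z = y"
  proof -
    have "sum (col_sums z) UNIV = sum y UNIV"
      using sum_row_sums[of z] sum_col_sums[of z] sum_supp[of x UNIV] sum_supp[of y UNIV] sx
      by (simp add: row P_def Q_def y)
    then have "\<forall>c\<in>UNIV. col_sums z c = y c"
      using cols sum_mono_inv[of "col_sums z" UNIV y] by (metis finite UNIV_I)
    then show ?thesis by auto
  qed
  \<comment> \<open>Elements of \<open>B\<close> with no supply get a potential so large that all their edges are slack.\<close>
  define M where "M = 1 + (\<Sum>i\<in>UNIV. \<bar>v $ i\<bar>) + (\<Sum>e\<in>UNIV. \<bar>a e\<bar>)"
  define v1 where "v1 = (\<chi> i. if i \<in> B - P then M else v $ i)"
  have same: "gain v1 e = gain v e" if "e \<in> P \<times> Q" for e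
    using that PB by (auto simp: v1_def gain_def Q_def)
  have slack: "gain v1 (b, c) < a (b, c)" if "b \<in> B - P" "c \<in> Q" for b c
  proof -
    have "gain v1 (b, c) = v $ c - M" using that by (auto simp: v1_def gain_def Q_def)
    moreover have "\<bar>v $ c\<bar> \<le> (\<Sum>i\<in>UNIV. \<bar>v $ i\<bar>)" by (rule member_le_sum) auto
    moreover have "\<bar>a (b, c)\<bar> \<le> (\<Sum>e\<in>UNIV. \<bar>a e\<bar>)" by (rule member_le_sum) auto
    ultimately show ?thesis unfolding M_def by linarith
  qed
  define T where "T = tight B (\<lambda>e. ereal (a e)) v1"
  have T: "T \<subseteq> B \<times> -B" unfolding T_def by (rule tight_subset)
  have zT: "supp z \<subseteq> T"
  proof
    fix e assume "e \<in> supp z"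
    then obtain b c where e: "e = (b, c)" "b \<in> P" "c \<in> N b" using z by (cases e) (auto simp: supp_def)
    then have "gain v1 e = a e" "e \<in> P \<times> Q" using same[of e] by (auto simp: N_def)
    then show "e \<in> T" using PB by (auto simp: T_def tight_def Q_def)
  qed
  have feas: "gain v1 e \<le> a e" if "e \<in> B \<times> -B" for e
  proof (cases "fst e \<in> P")
    case True
    then have "e \<in> P \<times> Q" using that by (auto simp: Q_def)
    then show ?thesis using same v by simp
  next
    case False
    then show ?thesis using that slack[of "fst e" "snd e"] by (auto simp: Q_def)
  qed
  obtain u :: "real ^ 'n" where u: "\<And>e. e \<in> T \<Longrightarrow> gain u e = (if e \<in> supp z then 0 else -1)"
    using gain_interpolation[OF T, of "\<lambda>e. if e \<in> supp z then 0 else -1"] gen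
    unfolding generic_costs_def T_def by metis
  have "\<forall>\<^sub>F \<epsilon> in at_right 0. \<forall>e\<in>B \<times> -B - T. gain v1 e + \<epsilon> * gain u e < a e + \<epsilon> * 0"
  proof (intro eventually_perturbed_less)
    fix e assume e: "e \<in> B \<times> -B - T"
    then have "gain v1 e \<noteq> a e" by (auto simp: T_def tight_def)
    then show "gain v1 e < a e" using feas[of e] e by simp
  qed simp
  then obtain r where r: "0 < r" "\<And>\<epsilon>. 0 < \<epsilon> \<Longrightarrow> \<epsilon> < r \<Longrightarrow>
      \<forall>e\<in>B \<times> -B - T. gain v1 e + \<epsilon> * gain u e < a e + \<epsilon> * 0"
    unfolding eventually_at_right_field by blast
  define \<epsilon> where "\<epsilon> = r / 2"
  have \<epsilon>: "0 < \<epsilon>" "\<And>e. e \<in> B \<times> -B - T \<Longrightarrow> gain v1 e + \<epsilon> * gain u e < a e"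
    using r(1) r(2)[of \<epsilon>] by (auto simp: \<epsilon>_def)
  have zB: "supp z \<subseteq> B \<times> -B" using zT T by blast
  have zcov: "-B \<subseteq> snd ` supp z" using y col supp_col_sums[of z] by simp
  have tt: "gain v1 e = a e" if "e \<in> T" for e using that by (simp add: T_def tight_def)
  have "v1 + \<epsilon> *\<^sub>R u \<in> cell B (\<lambda>e. ereal (a e)) (supp z)"
    unfolding mem_cell_iff[OF zB zcov]
  proof (intro conjI ballI)
    fix e assume "e \<in> supp z"
    then show "ereal (gain (v1 + \<epsilon> *\<^sub>R u) e) = ereal (a e)"
      using zT u[of e] tt[of e] by (auto simp: gain_add gain_scale)
  next
    fix e assume e: "e \<in> B \<times> -B - supp z"
    show "ereal (gain (v1 + \<epsilon> *\<^sub>R u) e) < ereal (a e)"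
    proof (cases "e \<in> T")
      case True
      then show ?thesis using e u[OF True] tt[OF True] \<epsilon>(1) by (simp add: gain_add gain_scale)
    next
      case False
      then show ?thesis using e \<epsilon>(2)[of e] by (simp add: gain_add gain_scale)
    qed
  qed
  then have "supp z \<in> tight_graphs B (\<lambda>e. ereal (a e))" using tight_graphs_cell by blast
  then show thesis using row col that by blast
qed

text \<open>
  The sum of \<open>z e * gain w e\<close> depends only on the degrees of \<open>z\<close>. Hence both \<open>z\<close> and \<open>z'\<close> are optimal
  transports for their common degrees, and complementary slackness puts each one on the tight graph of the
  other. On one forest the degrees determine the edge weights.
\<close>

lemma degrees_determine:
  fixes B :: "'n::finite set"
  assumes gen: "generic_costs B a"
    and z: "supp z \<in> tight_graphs B (\<lambda>e. ereal (a e))" and z': "supp z' \<in> tight_graphs B (\<lambda>e. ereal (a e))"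
    and row: "row_sums z = row_sums z'" and col: "col_sums z = col_sums z'"
  shows "z = z'"
proof -
  have swap: "(\<Sum>e\<in>UNIV. real (z e) * gain w e) = (\<Sum>e\<in>UNIV. real (z' e) * gain w e)" for w
    by (simp add: weighted_gain row col)
  obtain v v' where v: "v \<in> cell B (\<lambda>e. ereal (a e)) (supp z)" and v': "v' \<in> cell B (\<lambda>e. ereal (a e)) (supp z')"
    using z z' tight_graphs_cell by blast
  have cost: "(\<Sum>e\<in>UNIV. real (t e) * gain w e) = (\<Sum>e\<in>UNIV. real (t e) * a e)"
    if "w \<in> cell B (\<lambda>e. ereal (a e)) (supp t)" for t w
  proof (intro sum.cong refl)
    fix e
    show "real (t e) * gain w e = real (t e) * a e"
    proof (cases "e \<in> supp t")
      case True
      then have "ereal (gain w e) = ereal (a e)" using that by (auto simp: cell_def tight_def)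
      then show ?thesis by simp
    qed (simp add: supp_def)
  qed
  have bound: "real (t e) * gain w e \<le> real (t e) * a e"
    if "supp t \<subseteq> B \<times> -B" "w \<in> cell B (\<lambda>e. ereal (a e)) G" for t w e and G
  proof (cases "e \<in> supp t")
    case True
    then have "e \<in> B \<times> -B" using that(1) by blast
    then have "ereal (gain w e) \<le> ereal (a e)"
      using that(2) unfolding cell_def min_graph_def feasible_def by blast
    then show ?thesis by (simp add: mult_left_mono)
  qed (simp add: supp_def)
  have sub: "supp t' \<subseteq> supp t"
    if t: "w \<in> cell B (\<lambda>e. ereal (a e)) (supp t)" and t': "w' \<in> cell B (\<lambda>e. ereal (a e)) (supp t')"
      and tB: "supp t \<subseteq> B \<times> -B" "supp t' \<subseteq> B \<times> -B"
      and sw: "\<And>w. (\<Sum>e\<in>UNIV. real (t e) * gain w e) = (\<Sum>e\<in>UNIV. real (t' e) * gain w e)" for t t' w w'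
  proof -
    have "(\<Sum>e\<in>UNIV. real (t' e) * a e) = (\<Sum>e\<in>UNIV. real (t e) * gain w' e)"
      using cost[OF t'] sw by simp
    also have "\<dots> \<le> (\<Sum>e\<in>UNIV. real (t e) * a e)"
      by (rule sum_mono) (rule bound[OF tB(1) t'])
    also have "\<dots> = (\<Sum>e\<in>UNIV. real (t' e) * gain w e)" using cost[OF t] sw by simp
    finally have "(\<Sum>e\<in>UNIV. real (t' e) * gain w e) = (\<Sum>e\<in>UNIV. real (t' e) * a e)"
      using sum_mono[of UNIV "\<lambda>e. real (t' e) * gain w e" "\<lambda>e. real (t' e) * a e", OF bound[OF tB(2) t]]
      by simp
    then have eq: "real (t' e) * gain w e = real (t' e) * a e" for e
      by (rule sum_mono_inv) (auto intro: bound[OF tB(2) t])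
    show ?thesis
    proof
      fix e assume e: "e \<in> supp t'"
      then have "gain w e = a e" using eq[of e] by (simp add: supp_def)
      then have "e \<in> tight B (\<lambda>e. ereal (a e)) w" using e tB(2) unfolding tight_def by auto
      then show "e \<in> supp t" using t by (simp add: cell_def)
    qed
  qed
  note zB = tight_graphs_subset[OF z] and z'B = tight_graphs_subset[OF z']
  have G: "supp z = supp z'"
    using sub[OF v v' zB z'B swap] sub[OF v' v z'B zB swap[symmetric]] by blast
  have "independent (edge_vec ` supp z :: (real ^ 'n) set)"
    using gen z by (auto simp: generic_costs_def tight_graphs_def)
  then obtain u :: "real ^ 'n" where u: "\<And>e. e \<in> supp z \<Longrightarrow> gain u e = real (z e) - real (z' e)"
    using gain_interpolation[OF zB, of "\<lambda>e. real (z e) - real (z' e)"] by metis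
  have "(\<Sum>e\<in>supp z. (real (z e) - real (z' e))\<^sup>2) = (\<Sum>e\<in>supp z. (real (z e) - real (z' e)) * gain u e)"
    by (intro sum.cong) (auto simp: u power2_eq_square)
  also have "\<dots> = (\<Sum>e\<in>UNIV. (real (z e) - real (z' e)) * gain u e)"
  proof (intro sum.mono_neutral_left ballI)
    fix e assume "e \<in> UNIV - supp z"
    then have "e \<notin> supp z" "e \<notin> supp z'" using G by auto
    then show "(real (z e) - real (z' e)) * gain u e = 0" by (simp add: supp_def)
  qed auto
  also have "\<dots> = 0" using swap[of u] by (simp add: left_diff_distrib sum_subtractf)
  finally have "\<forall>e\<in>supp z. (real (z e) - real (z' e))\<^sup>2 = 0"
    by (subst (asm) sum_nonneg_eq_0_iff) auto
  show "z = z'"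
  proof
    fix e
    show "z e = z' e"
    proof (cases "e \<in> supp z")
      case True
      then show ?thesis using \<open>\<forall>e\<in>supp z. (real (z e) - real (z' e))\<^sup>2 = 0\<close> by simp
    next
      case False
      then have "e \<notin> supp z'" using G by simp
      then show ?thesis using False by (simp add: supp_def)
    qed
  qed
qed

section \<open>Counting tight graphs of generic costs\<close>


definition compositions :: "'e set \<Rightarrow> nat \<Rightarrow> ('e \<Rightarrow> nat) set" where
  "compositions A N = {f. supp f \<subseteq> A \<and> sum f A = N}"

definition pos_compositions :: "'e set \<Rightarrow> nat \<Rightarrow> ('e \<Rightarrow> nat) set" where
  "pos_compositions A N = {f. supp f = A \<and> sum f A = N}"

text \<open>
  Pascal's rule: either \<open>f a = 0\<close>, or one unit can be taken away at \<open>a\<close>.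
\<close>

lemma compositions_insert_Suc:
  assumes "finite A" and "a \<notin> A"
  shows "compositions (insert a A) (Suc N)
     = compositions A (Suc N) \<union> (\<lambda>f. f(a := Suc (f a))) ` compositions (insert a A) N" (is "?L = ?R")
proof (intro equalityI subsetI)
  fix f assume f: "f \<in> ?L"
  show "f \<in> ?R"
  proof (cases "f a")
    case 0
    then have "f \<in> compositions A (Suc N)"
      using f assms by (auto simp: compositions_def supp_def)
    then show ?thesis by blast
  next
    case (Suc k)
    have "sum (f(a := k)) A = sum f A" using assms by (intro sum.cong) auto
    then have "f(a := k) \<in> compositions (insert a A) N"
      using f assms Suc by (auto simp: compositions_def supp_def)
    moreover have "f = (f(a := k))(a := Suc ((f(a := k)) a))" using Suc by auto
    ultimately show ?thesis by blast
  qed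
next
  fix f assume "f \<in> ?R"
  then consider "f \<in> compositions A (Suc N)"
    | g where "g \<in> compositions (insert a A) N" "f = g(a := Suc (g a))" by blast
  then show "f \<in> ?L"
  proof cases
    case 1
    then show ?thesis using assms by (auto simp: compositions_def supp_def)
  next
    case 2
    have "sum f A = sum g A" using assms 2 by (intro sum.cong) auto
    then show ?thesis using assms 2 by (auto simp: compositions_def supp_def split: if_splits)
  qed
qed

lemma card_compositions_insert:
  assumes "finite A" and "a \<notin> A"
  shows "finite (compositions (insert a A) N) \<and> card (compositions (insert a A) N) = (N + card A) choose card A"
  using assms
proof (induction "card A + N" arbitrary: A a N rule: less_induct)
  case less
  show ?case
  proof (cases N)
    case 0
    have "compositions (insert a A) 0 = {\<lambda>_. 0}"
      using less.prems by (fastforce simp: compositions_def supp_def fun_eq_iff)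
    then show ?thesis using 0 by simp
  next
    case (Suc M)
    have IH: "finite (compositions (insert a A) M)" "card (compositions (insert a A) M) = (M + card A) choose card A"
      using less.hyps[of A M a] less.prems Suc by auto
    have inj: "inj_on (\<lambda>f. f(a := Suc (f a))) (compositions (insert a A) M)"
    proof (rule inj_onI)
      fix f g :: "'a \<Rightarrow> nat" assume "f(a := Suc (f a)) = g(a := Suc (g a))"
      then have "(f(a := Suc (f a))) e = (g(a := Suc (g a))) e" for e by simp
      then have "f e = g e" for e by (cases "e = a") (metis fun_upd_apply nat.inject)+
      then show "f = g" by auto
    qed
    have disj: "compositions A (Suc M) \<inter> (\<lambda>f. f(a := Suc (f a))) ` compositions (insert a A) M = {}"
      using less.prems(2) by (auto simp: compositions_def supp_def)
    have A: "finite (compositions A (Suc M)) \<and> card (compositions A (Suc M)) + ((M + card A) choose card A)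
        = (Suc M + card A) choose card A"
    proof (cases "A = {}")
      case True
      then show ?thesis by (auto simp: compositions_def)
    next
      case False
      then obtain a' A' where A': "A = insert a' A'" "a' \<notin> A'" "finite A'"
        using less.prems(1) by (metis Set.set_insert ex_in_conv finite_insert)
      then have "finite (compositions A (Suc M))" "card (compositions A (Suc M)) = (Suc M + card A') choose card A'"
        using less.hyps[of A' "Suc M" a'] Suc by auto
      then show ?thesis using A' by simp
    qed
    show ?thesis
      unfolding Suc compositions_insert_Suc[OF less.prems]
      using A IH disj by (simp add: card_Un_disjoint card_image[OF inj])
  qed
qed

lemma card_compositions:
  assumes "finite A" and "A \<noteq> {}"
  shows "finite (compositions A N)" and "card (compositions A N) = (N + card A - 1) choose (card A - 1)"
proof -
  obtain a A' where "A = insert a A'" "a \<notin> A'" "finite A'"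
    using assms by (metis Set.set_insert ex_in_conv finite_insert)
  then show "finite (compositions A N)" "card (compositions A N) = (N + card A - 1) choose (card A - 1)"
    using card_compositions_insert[of A' a N] by simp_all
qed

lemma card_pos_compositions:
  assumes fin: "finite A" and ne: "A \<noteq> {}"
  shows "finite (pos_compositions A (Suc M))" and "card (pos_compositions A (Suc M)) = M choose (card A - 1)"
proof -
  have "pos_compositions A (Suc M) \<subseteq> compositions A (Suc M)"
    by (auto simp: pos_compositions_def compositions_def)
  then show "finite (pos_compositions A (Suc M))" by (rule finite_subset) (rule card_compositions[OF assms])
  have cA: "0 < card A" using assms by (simp add: card_gt_0_iff)
  have shift: "sum f A = sum (\<lambda>e. f e - 1) A + card A" if "supp f = A" for f :: "'a \<Rightarrow> nat"
  proof -
    have "sum f A = (\<Sum>e\<in>A. (f e - 1) + 1)" using that by (intro sum.cong) (auto simp: supp_def)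
    then show ?thesis by (simp only: sum.distrib) simp
  qed
  show "card (pos_compositions A (Suc M)) = M choose (card A - 1)"
  proof (cases "card A \<le> Suc M")
    case False
    then have "pos_compositions A (Suc M) = {}" using shift by (force simp: pos_compositions_def)
    then show ?thesis using False by (simp add: binomial_eq_0)
  next
    case True
    have "bij_betw (\<lambda>f e. f e - 1) (pos_compositions A (Suc M)) (compositions A (Suc M - card A))"
    proof (rule bij_betw_byWitness[where f' = "\<lambda>f e. if e \<in> A then f e + 1 else 0"])
      show "\<forall>f\<in>pos_compositions A (Suc M). (\<lambda>e. if e \<in> A then (f e - 1) + 1 else 0) = f"
        by (auto simp: pos_compositions_def supp_def fun_eq_iff)
      show "\<forall>f\<in>compositions A (Suc M - card A). (\<lambda>e. (if e \<in> A then f e + 1 else 0) - 1) = f"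
        by (auto simp: compositions_def supp_def fun_eq_iff)
      show "(\<lambda>f e. f e - 1) ` pos_compositions A (Suc M) \<subseteq> compositions A (Suc M - card A)"
      proof (rule image_subsetI)
        fix f assume "f \<in> pos_compositions A (Suc M)"
        then have f: "supp f = A" "sum f A = Suc M" by (auto simp: pos_compositions_def)
        have "sum (\<lambda>e. f e - 1) A = Suc M - card A" using shift[OF f(1)] f(2) by linarith
        moreover have "supp (\<lambda>e. f e - 1) \<subseteq> A" using f(1) by (auto simp: supp_def)
        ultimately show "(\<lambda>e. f e - 1) \<in> compositions A (Suc M - card A)" by (simp add: compositions_def)
      qed
      show "(\<lambda>f e. if e \<in> A then f e + 1 else 0) ` compositions A (Suc M - card A) \<subseteq> pos_compositions A (Suc M)"
        using True fin by (auto simp: compositions_def pos_compositions_def supp_def sum_Suc)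
    qed
    then have "card (pos_compositions A (Suc M)) = (Suc M - card A + card A - 1) choose (card A - 1)"
      by (simp add: bij_betw_same_card card_compositions(2)[OF assms])
    then show ?thesis using True by simp
  qed
qed

text \<open>
  Both sides count the edge weights \<open>z\<close> with total \<open>M + 1\<close> whose support is a tight graph satisfying
  \<open>P\<close>: on the left by the support, on the right by the degree vectors, which determine \<open>z\<close>. The
  degrees outside \<open>B\<close> can be any positive numbers with this total, those in \<open>B\<close> any nonnegative
  ones whose support satisfies \<open>P\<close>.
\<close>

lemma graph_count:
  fixes B :: "'n::finite set"
  assumes gen: "generic_costs B a" and ne: "-B \<noteq> {}"
  shows "(\<Sum>G\<in>{G \<in> tight_graphs B (\<lambda>e. ereal (a e)). P (fst ` G)}. M choose (card G - 1))
     = card {x \<in> compositions B (Suc M). P (supp x)} * (M choose (card (-B) - 1))"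
proof -
  let ?\<G> = "{G \<in> tight_graphs B (\<lambda>e. ereal (a e)). P (fst ` G)}"
  have Gne: "G \<noteq> {}" if "G \<in> ?\<G>" for G using that tight_graphs_cover[of G B] ne by auto
  define Z where "Z = (\<Union>G\<in>?\<G>. pos_compositions G (Suc M))"
  have memZ: "z \<in> Z \<longleftrightarrow> supp z \<in> ?\<G> \<and> sum z UNIV = Suc M" for z
    using sum_supp[of z UNIV] by (auto simp: Z_def pos_compositions_def)
  have "card Z = (\<Sum>G\<in>?\<G>. card (pos_compositions G (Suc M)))"
    unfolding Z_def
  proof (rule card_UN_disjoint)
    show "\<forall>G\<in>?\<G>. finite (pos_compositions G (Suc M))"
      using card_pos_compositions(1) Gne by (metis finite)
  qed (auto simp: pos_compositions_def)
  also have "\<dots> = (\<Sum>G\<in>?\<G>. M choose (card G - 1))"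
    by (intro sum.cong refl card_pos_compositions Gne) auto
  finally have cZ: "card Z = (\<Sum>G\<in>?\<G>. M choose (card G - 1))" .
  let ?D = "\<lambda>z. (row_sums z, col_sums z)"
  have "bij_betw ?D Z ({x \<in> compositions B (Suc M). P (supp x)} \<times> pos_compositions (-B) (Suc M))"
    unfolding bij_betw_def
  proof (intro conjI equalityI subsetI)
    show "inj_on ?D Z"
      using degrees_determine[OF gen] memZ by (intro inj_onI) auto
    fix d assume "d \<in> ?D ` Z"
    then obtain z where z: "d = ?D z" "supp z \<in> ?\<G>" "sum z UNIV = Suc M" using memZ by auto
    then have "supp z \<in> tight_graphs B (\<lambda>e. ereal (a e))" by simp
    note sB = tight_graphs_subset[OF this] tight_graphs_cover[OF this]
    have r: "supp (row_sums z) \<subseteq> B" using sB(1) by (auto simp: supp_row_sums)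
    have c: "supp (col_sums z) = -B" using sB by (auto simp: supp_col_sums)
    have "sum (row_sums z) B = Suc M"
      using sum_supp[OF r] sum_supp[of "row_sums z" UNIV] sum_row_sums[of z] z(3) by simp
    moreover have "sum (col_sums z) (-B) = Suc M"
      using sum_supp[of "col_sums z" UNIV] sum_col_sums[of z] z(3) c by simp
    moreover have "P (supp (row_sums z))" using z(2) by (simp add: supp_row_sums)
    ultimately show "d \<in> {x \<in> compositions B (Suc M). P (supp x)} \<times> pos_compositions (-B) (Suc M)"
      using z(1) r c by (simp add: compositions_def pos_compositions_def)
  next
    fix d assume "d \<in> {x \<in> compositions B (Suc M). P (supp x)} \<times> pos_compositions (-B) (Suc M)"
    then obtain x y where d: "d = (x, y)" and x: "supp x \<subseteq> B" "sum x B = Suc M" "P (supp x)"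
      and y: "supp y = -B" "sum y (-B) = Suc M"
      by (auto simp: compositions_def pos_compositions_def)
    obtain z where z: "supp z \<in> tight_graphs B (\<lambda>e. ereal (a e))" "row_sums z = x" "col_sums z = y"
      using realize_degrees[OF gen ne x(1) y(1)] x(2) y(2) by auto
    have "sum z UNIV = Suc M"
      using sum_row_sums[of z] z(2) x(2) sum_supp[OF x(1)] sum_supp[of x UNIV] by simp
    moreover have "P (fst ` supp z)" using x(3) z(2) by (simp flip: supp_row_sums)
    ultimately have "z \<in> Z" using z(1) by (simp add: memZ)
    then show "d \<in> ?D ` Z" using d z by auto
  qed
  from bij_betw_same_card[OF this] show ?thesis
    using cZ card_pos_compositions(2)[of "-B" M] ne by (simp add: card_cartesian_product)
qed

text \<open>
  Vandermonde's identity for \<open>(M - q) + r\<close>, followed by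
  \<open>(M choose q) * (M - q choose s) = (M choose q + s) * (q + s choose s)\<close>.
\<close>

lemma binomial_product_expansion:
  assumes "q \<le> r"
  shows "(M choose q) * ((M + (r - q)) choose p) = (\<Sum>s\<le>p. ((q + s) choose s) * (r choose (p - s)) * (M choose (q + s)))"
proof (cases "q \<le> M")
  case True
  have "(M + (r - q)) choose p = (\<Sum>s\<le>p. ((M - q) choose s) * (r choose (p - s)))"
    using vandermonde[of "M - q" r p] assms True by simp
  then have "(M choose q) * ((M + (r - q)) choose p)
      = (\<Sum>s\<le>p. (M choose q) * (((M - q) choose s) * (r choose (p - s))))"
    by (simp only: sum_distrib_left)
  also have "\<dots> = (\<Sum>s\<le>p. ((q + s) choose s) * (r choose (p - s)) * (M choose (q + s)))"
  proof (intro sum.cong refl)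
    fix s
    have "(M choose q) * ((M - q) choose s) = (M choose (q + s)) * ((q + s) choose s)"
    proof (cases "q + s \<le> M")
      case True
      then have "(M choose (q + s)) * ((q + s) choose q) = (M choose q) * ((M - q) choose s)"
        using choose_mult[of q "q + s" M] by simp
      moreover have "(q + s) choose q = (q + s) choose s"
        using binomial_symmetric[of q "q + s"] by simp
      ultimately show ?thesis by simp
    next
      case False
      then have "M - q < s" using True by linarith
      then show ?thesis using False by (simp add: binomial_eq_0)
    qed
    then show "(M choose q) * (((M - q) choose s) * (r choose (p - s)))
        = ((q + s) choose s) * (r choose (p - s)) * (M choose (q + s))"
      by (metis mult.assoc mult.commute)
  qed
  finally show ?thesis .
qed (simp add: binomial_eq_0)

text \<open>
  The binomial coefficients \<open>M choose j\<close> are triangular in \<open>j\<close> and \<open>M\<close>.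
\<close>

lemma binomial_coefficients_unique:
  fixes g h :: "nat \<Rightarrow> nat"
  assumes eq: "\<And>M. (\<Sum>j<K. g j * (M choose j)) = (\<Sum>j<K. h j * (M choose j))" and "j < K"
  shows "g j = h j"
  using \<open>j < K\<close>
proof (induction j rule: less_induct)
  case (less j)
  have split: "(\<Sum>i<K. f i * (j choose i)) = (\<Sum>i<j. f i * (j choose i)) + f j" for f :: "nat \<Rightarrow> nat"
  proof -
    have "(\<Sum>i<K. f i * (j choose i)) = (\<Sum>i<Suc j. f i * (j choose i))"
      using less.prems by (intro sum.mono_neutral_right) (auto simp: binomial_eq_0)
    then show ?thesis by simp
  qed
  have "(\<Sum>i<j. g i * (j choose i)) = (\<Sum>i<j. h i * (j choose i))"
    using less by (intro sum.cong) auto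
  then show ?case using eq[of j] unfolding split by simp
qed

text \<open>
  Expanding the right-hand side of the count above in the polynomials \<open>M choose j\<close> reads off the number of
  tight graphs with \<open>j + 1\<close> edges. The parameter \<open>r\<close> allows the two cases of all tight graphs
  and of those without isolated vertices to be treated together.
\<close>

lemma generic_graph_numbers_filtered:
  fixes B :: "'n::finite set"
  assumes gen: "generic_costs B a" and ne: "-B \<noteq> {}" "B \<noteq> {}"
    and r: "card (-B) - 1 \<le> r"
    and cnt: "\<And>M. card {x \<in> compositions B (Suc M). P (supp x)} = (M + (r - (card (-B) - 1))) choose (card B - 1)"
    and i: "1 \<le> i" "i \<le> card B"
  shows "card {G \<in> tight_graphs B (\<lambda>e. ereal (a e)). P (fst ` G) \<and> dim (constant_along G :: (real ^ 'n) set) = i}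
    = ((CARD('n) - i - 1) choose (card B - i)) * (r choose (i - 1))"
proof -
  define n where "n = CARD('n)"
  define q where "q = card (-B) - 1"
  define p where "p = card B - 1"
  have cB: "0 < card B" "0 < card (-B)" "card B + card (-B) = n"
    using ne card_Un_disjoint[of B "-B"] by (auto simp: card_gt_0_iff n_def)
  let ?\<G> = "{G \<in> tight_graphs B (\<lambda>e. ereal (a e)). P (fst ` G)}"
  define g where "g j = card {G \<in> ?\<G>. card G - 1 = j}" for j
  define h where "h j = (if q \<le> j \<and> j \<le> q + p then (j choose (j - q)) * (r choose (p - (j - q))) else 0)" for j
  have pos: "0 < card G" if "G \<in> ?\<G>" for G
    using that tight_graphs_cover[of G B] ne by (auto simp: card_gt_0_iff)
  have dimG: "dim (constant_along G :: (real ^ 'n) set) + card G = n" if "G \<in> ?\<G>" for G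
    using generic_card[OF gen] that by (simp add: n_def)
  have expansion: "(\<Sum>j<n. g j * (M choose j)) = (\<Sum>j<n. h j * (M choose j))" for M
  proof -
    have "(\<Sum>G\<in>?\<G>. M choose (card G - 1)) = (\<Sum>j<n. \<Sum>G\<in>{G \<in> ?\<G>. card G - 1 = j}. M choose (card G - 1))"
    proof (rule sum.group[symmetric])
      show "(\<lambda>G. card G - 1) ` ?\<G> \<subseteq> {..<n}" using pos dimG by (force simp: less_le_trans)
    qed auto
    also have "\<dots> = (\<Sum>j<n. g j * (M choose j))"
      by (intro sum.cong refl) (simp add: g_def)
    finally have "(\<Sum>j<n. g j * (M choose j)) = (M choose q) * ((M + (r - q)) choose p)"
      using graph_count[OF gen ne(1), where P = P and M = M] cnt[of M] by (simp add: q_def p_def mult.commute)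
    also have "\<dots> = (\<Sum>s\<le>p. ((q + s) choose s) * (r choose (p - s)) * (M choose (q + s)))"
      using r by (intro binomial_product_expansion) (simp add: q_def)
    also have "\<dots> = (\<Sum>j\<in>{q..q + p}. h j * (M choose j))"
      by (rule sum.reindex_bij_witness[where i = "\<lambda>j. j - q" and j = "\<lambda>s. q + s"]) (auto simp: h_def)
    also have "\<dots> = (\<Sum>j<n. h j * (M choose j))"
      using cB by (intro sum.mono_neutral_left) (auto simp: h_def q_def p_def)
    finally show ?thesis .
  qed
  have "n - i - 1 < n" using cB by linarith
  with expansion have "g (n - i - 1) = h (n - i - 1)" by (rule binomial_coefficients_unique)
  moreover have "{G \<in> tight_graphs B (\<lambda>e. ereal (a e)). P (fst ` G) \<and> dim (constant_along G :: (real ^ 'n) set) = i}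
      = {G \<in> ?\<G>. card G - 1 = n - i - 1}"
  proof -
    have "dim (constant_along G :: (real ^ 'n) set) = i \<longleftrightarrow> card G - 1 = n - i - 1" if "G \<in> ?\<G>" for G
      using dimG[OF that] pos[OF that] i cB by linarith
    then show ?thesis by auto
  qed
  moreover have "n - i - 1 - q = card B - i" "p - (card B - i) = i - 1" "q \<le> n - i - 1" "n - i - 1 \<le> q + p"
    using i cB by (simp_all add: q_def p_def)
  ultimately show ?thesis by (simp add: g_def h_def n_def)
qed

theorem generic_graph_numbers:
  fixes B :: "'n::finite set"
  assumes gen: "generic_costs B a" and ne: "-B \<noteq> {}" "B \<noteq> {}" and i: "1 \<le> i" "i \<le> card B"
  shows "card {G \<in> tight_graphs B (\<lambda>e. ereal (a e)). dim (constant_along G :: (real ^ 'n) set) = i}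
    = ((CARD('n) - i - 1) choose (card B - i)) * ((CARD('n) - 1) choose (i - 1))" (is ?all)
    and "card {G \<in> tight_graphs B (\<lambda>e. ereal (a e)). B \<subseteq> fst ` G \<and> dim (constant_along G :: (real ^ 'n) set) = i}
    = ((CARD('n) - i - 1) choose (card B - i)) * ((CARD('n) - card B - 1) choose (i - 1))" (is ?covering)
proof -
  have cB: "0 < card B" "0 < card (-B)" "card B + card (-B) = CARD('n)"
    using ne card_Un_disjoint[of B "-B"] by (auto simp: card_gt_0_iff)
  have "CARD('n) - 1 - (card (-B) - 1) = card B" using cB by linarith
  then have "card {x \<in> compositions B (Suc M). True}
      = (M + (CARD('n) - 1 - (card (-B) - 1))) choose (card B - 1)" for M
    using card_compositions(2)[of B "Suc M"] ne by simp
  note cnt = this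
  have "card (-B) - 1 \<le> CARD('n) - 1" using cB by linarith
  then show ?all
    using generic_graph_numbers_filtered[where P = "\<lambda>_. True", OF gen ne _ cnt i] by simp
  have "{x \<in> compositions B (Suc M). B \<subseteq> supp x} = pos_compositions B (Suc M)" for M
    by (auto simp: compositions_def pos_compositions_def)
  then have "card {x \<in> compositions B (Suc M). B \<subseteq> supp x}
      = (M + (card (-B) - 1 - (card (-B) - 1))) choose (card B - 1)" for M
    using card_pos_compositions(2)[of B M] ne by simp
  note cnt = this
  have e: "card (-B) - 1 = CARD('n) - card B - 1" using cB by linarith
  show ?covering
    using generic_graph_numbers_filtered[where P = "\<lambda>S. B \<subseteq> S", OF gen ne order.refl cnt i] by (simp only: e)
qed

section \<open>A Pluecker vector with prescribed exchange costs\<close>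


text \<open>
  The matrix \<open>w\<close> has its rows in \<open>R\<close>; minimum weights of matchings with column sets \<open>A\<close> are its tropical
  maximal minors.
\<close>

definition matching_weights :: "('n \<Rightarrow> 'n \<Rightarrow> ereal) \<Rightarrow> 'n set \<Rightarrow> 'n set \<Rightarrow> ereal set" where
  "matching_weights w R A = {\<Sum>r\<in>R. w r (\<sigma> r) | \<sigma>. bij_betw \<sigma> R A}"

definition min_matching :: "('n \<Rightarrow> 'n \<Rightarrow> ereal) \<Rightarrow> 'n set \<Rightarrow> 'n set \<Rightarrow> ereal" where
  "min_matching w R A = Inf (matching_weights w R A)"

text \<open>
  Follow the path that starts at the column \<open>i\<close> and alternates between \<open>\<sigma>\<close> and \<open>\<tau>\<close>, until it reaches a
  column \<open>j\<close> outside \<open>S\<close>, and swap the two matchings along it. Formally, the row matched to \<open>i\<close> by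
  \<open>\<sigma>\<close> is removed and the rest of the path is found by induction.
\<close>

lemma alternating_path_exchange:
  fixes w :: "'n::finite \<Rightarrow> 'n \<Rightarrow> ereal"
  assumes "bij_betw \<sigma> R (insert i S)" and "bij_betw \<tau> R (T - {i})" and "i \<in> T" "i \<notin> S"
  shows "\<exists>j \<sigma>' \<tau>'. j \<in> T \<and> j \<notin> S \<and> j \<noteq> i \<and> bij_betw \<sigma>' R (insert j S) \<and> bij_betw \<tau>' R (T - {j})
     \<and> (\<Sum>r\<in>R. w r (\<sigma>' r)) + (\<Sum>r\<in>R. w r (\<tau>' r)) = (\<Sum>r\<in>R. w r (\<sigma> r)) + (\<Sum>r\<in>R. w r (\<tau> r))"
  using assms
proof (induction "card R" arbitrary: R S T i)
  case 0
  then show ?case by (simp add: bij_betw_def)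
next
  case (Suc k)
  have "i \<in> \<sigma> ` R" using Suc.prems(1) by (simp add: bij_betw_def)
  then obtain r where r: "r \<in> R" "\<sigma> r = i" by blast
  define e where "e = \<tau> r"
  have e: "e \<in> T" "e \<noteq> i" using Suc.prems(2) r by (auto simp: bij_betw_def e_def)
  define R' where "R' = R - {r}"
  have R: "R = insert r R'" "r \<notin> R'" using r by (auto simp: R'_def)
  have upd: "bij_betw (f(r := d)) R (insert d D)" if "bij_betw f R' D" "d \<notin> D" for f D d
  proof -
    have "bij_betw (f(r := d)) R' D"
      using that(1) by (rule bij_betw_cong[THEN iffD1, rotated]) (use R(2) in auto)
    moreover have "bij_betw (f(r := d)) {r} {d}" by simp
    ultimately have "bij_betw (f(r := d)) (R' \<union> {r}) (D \<union> {d})"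
      using that(2) by (intro bij_betw_combine) auto
    then show ?thesis by (simp add: R(1))
  qed
  have sums: "(\<Sum>s\<in>R. w s ((f(r := d)) s)) = w r d + (\<Sum>s\<in>R'. w s (f s))" for f d
  proof -
    have "(\<Sum>s\<in>R'. w s ((f(r := d)) s)) = (\<Sum>s\<in>R'. w s (f s))" using R(2) by (intro sum.cong) auto
    then show ?thesis using R by simp
  qed
  have s\<sigma>: "(\<Sum>s\<in>R. w s (\<sigma> s)) = w r i + (\<Sum>s\<in>R'. w s (\<sigma> s))"
    and s\<tau>: "(\<Sum>s\<in>R. w s (\<tau> s)) = w r e + (\<Sum>s\<in>R'. w s (\<tau> s))"
    using R r by (simp_all add: e_def)
  have b\<sigma>: "bij_betw \<sigma> R' S"
    using bij_betw_DiffI[OF Suc.prems(1), of "{r}" "{i}"] r Suc.prems(4) by (simp add: R'_def bij_betw_def)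
  have b\<tau>: "bij_betw \<tau> R' (T - {i} - {e})"
    using bij_betw_DiffI[OF Suc.prems(2), of "{r}" "{e}"] r e by (simp add: R'_def e_def bij_betw_def)
  show ?case
  proof (cases "e \<in> S")
    case False
    have "bij_betw (\<sigma>(r := e)) R (insert e S)" by (rule upd[OF b\<sigma> False])
    moreover have "bij_betw (\<tau>(r := i)) R (insert i (T - {i} - {e}))" by (rule upd[OF b\<tau>]) simp
    moreover have "insert i (T - {i} - {e}) = T - {e}" using e Suc.prems(3) by auto
    moreover have "(\<Sum>s\<in>R. w s ((\<sigma>(r := e)) s)) + (\<Sum>s\<in>R. w s ((\<tau>(r := i)) s))
        = (\<Sum>s\<in>R. w s (\<sigma> s)) + (\<Sum>s\<in>R. w s (\<tau> s))"
      unfolding sums s\<sigma> s\<tau> by (simp only: ac_simps)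
    ultimately show ?thesis using e False by metis
  next
    case True
    have "k = card R'" using Suc.hyps(2) R by simp
    moreover have "bij_betw \<sigma> R' (insert e (S - {e}))" using b\<sigma> True by (simp add: insert_absorb)
    ultimately obtain j \<sigma>' \<tau>' where j: "j \<in> T - {i}" "j \<notin> S - {e}" "j \<noteq> e"
      and b: "bij_betw \<sigma>' R' (insert j (S - {e}))" "bij_betw \<tau>' R' (T - {i} - {j})"
      and s: "(\<Sum>r\<in>R'. w r (\<sigma>' r)) + (\<Sum>r\<in>R'. w r (\<tau>' r)) = (\<Sum>r\<in>R'. w r (\<sigma> r)) + (\<Sum>r\<in>R'. w r (\<tau> r))"
      using Suc.hyps(1)[of R' e "S - {e}" "T - {i}"] b\<tau> e by auto
    have "bij_betw (\<sigma>'(r := e)) R (insert e (insert j (S - {e})))" by (rule upd[OF b(1)]) (use j in auto)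
    moreover have "insert e (insert j (S - {e})) = insert j S" using True by auto
    moreover have "bij_betw (\<tau>'(r := i)) R (insert i (T - {i} - {j}))" by (rule upd[OF b(2)]) simp
    moreover have "insert i (T - {i} - {j}) = T - {j}" using j Suc.prems(3) by auto
    moreover have "(\<Sum>s\<in>R. w s ((\<sigma>'(r := e)) s)) + (\<Sum>s\<in>R. w s ((\<tau>'(r := i)) s))
        = (\<Sum>s\<in>R. w s (\<sigma> s)) + (\<Sum>s\<in>R. w s (\<tau> s))"
    proof -
      have "(\<Sum>s\<in>R. w s ((\<sigma>'(r := e)) s)) + (\<Sum>s\<in>R. w s ((\<tau>'(r := i)) s))
         = w r e + w r i + ((\<Sum>r\<in>R'. w r (\<sigma>' r)) + (\<Sum>r\<in>R'. w r (\<tau>' r)))"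
        unfolding sums by (simp only: ac_simps)
      then show ?thesis unfolding s s\<sigma> s\<tau> by (simp only: ac_simps)
    qed
    moreover have "j \<in> T" "j \<notin> S" "j \<noteq> i" using j by auto
    ultimately show ?thesis by metis
  qed
qed

lemma min_matching_le: "bij_betw \<sigma> R A \<Longrightarrow> min_matching w R A \<le> (\<Sum>r\<in>R. w r (\<sigma> r))"
  unfolding min_matching_def matching_weights_def by (intro Inf_lower) blast

lemma min_matching_attained:
  fixes w :: "'n::finite \<Rightarrow> 'n \<Rightarrow> ereal"
  assumes "card R = card A"
  obtains \<sigma> where "bij_betw \<sigma> R A" "min_matching w R A = (\<Sum>r\<in>R. w r (\<sigma> r))"
proof -
  have "finite (matching_weights w R A)"
    by (rule finite_subset[of _ "(\<lambda>\<sigma>. \<Sum>r\<in>R. w r (\<sigma> r)) ` UNIV"]) (auto simp: matching_weights_def)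
  moreover have "matching_weights w R A \<noteq> {}"
    using finite_same_card_bij[of R A] assms by (auto simp: matching_weights_def)
  ultimately have "Inf (matching_weights w R A) \<in> matching_weights w R A"
    by (metis Min_Inf Min_in)
  then show thesis using that by (auto simp: matching_weights_def min_matching_def)
qed

text \<open>
  Tropical maximal minors satisfy the tropical Pluecker relations: at an index \<open>i\<close> attaining the minimum, the
  exchange along an alternating path provides a second index \<open>j\<close> with a value that is no larger.
\<close>

lemma trop_plucker_min_matching:
  fixes w :: "'n::finite \<Rightarrow> 'n \<Rightarrow> ereal"
  assumes noneg: "\<And>r e. w r e \<noteq> -\<infinity>" and A: "card A = card R" "min_matching w R A \<noteq> \<infinity>"
  shows "trop_plucker (card R) (min_matching w R)"
  unfolding trop_plucker_def
proof (intro conjI allI impI)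
  fix A :: "'n set" assume "card A = card R"
  then obtain \<sigma> where "min_matching w R A = (\<Sum>r\<in>R. w r (\<sigma> r))" using min_matching_attained[of R A w] by metis
  moreover have "(\<Sum>r\<in>R. w r (\<sigma> r)) \<noteq> -\<infinity>"
    by (induction R rule: infinite_finite_induct) (simp_all add: noneg)
  ultimately show "min_matching w R A \<noteq> -\<infinity>" by simp
next
  show "\<exists>A. card A = card R \<and> min_matching w R A \<noteq> \<infinity>" using A by blast
next
  fix S T :: "'n set" assume ST: "card S + 1 = card R \<and> card T = card R + 1"
  define f where "f i = min_matching w R (insert i S) + min_matching w R (T - {i})" for i
  have "\<not> T \<subseteq> S" using ST card_mono[of S T] by auto
  then have "T - S \<noteq> {}" by blast
  then have "Min (f ` (T - S)) \<in> f ` (T - S)" by (intro Min_in) auto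
  then obtain i where i: "i \<in> T" "i \<notin> S" and fi: "f i = Min (f ` (T - S))" by auto
  have "card R = card (insert i S)" "card R = card (T - {i})" using ST i by auto
  then obtain \<sigma> \<tau> where \<sigma>: "bij_betw \<sigma> R (insert i S)" "min_matching w R (insert i S) = (\<Sum>r\<in>R. w r (\<sigma> r))"
    and \<tau>: "bij_betw \<tau> R (T - {i})" "min_matching w R (T - {i}) = (\<Sum>r\<in>R. w r (\<tau> r))"
    using min_matching_attained by metis
  obtain j \<sigma>' \<tau>' where j: "j \<in> T" "j \<notin> S" "j \<noteq> i"
    and b: "bij_betw \<sigma>' R (insert j S)" "bij_betw \<tau>' R (T - {j})"
    and s: "(\<Sum>r\<in>R. w r (\<sigma>' r)) + (\<Sum>r\<in>R. w r (\<tau>' r)) = (\<Sum>r\<in>R. w r (\<sigma> r)) + (\<Sum>r\<in>R. w r (\<tau> r))"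
    using alternating_path_exchange[OF \<sigma>(1) \<tau>(1) i] by blast
  have "f j \<le> f i"
    unfolding f_def \<sigma>(2) \<tau>(2) s[symmetric] by (intro add_mono min_matching_le b)
  moreover have "Min (f ` (T - S)) \<le> f j" using j by (intro Min_le) auto
  ultimately have "f j = Min (f ` (T - S))" using fi by simp
  then show "trop_vanishes (T - S) (\<lambda>i. min_matching w R (insert i S) + min_matching w R (T - {i}))"
    using i j fi unfolding trop_vanishes_def f_def[symmetric] by blast
qed

text \<open>
  Take the maximal minors of the tropical matrix \<open>[I | a]\<close>, with \<open>I\<close> the tropical identity matrix on the
  columns in \<open>B\<close>. A matching of finite weight with the columns \<open>B - b + c\<close> fixes all columns in
  \<open>B - b\<close>.
\<close>

lemma exists_plucker_with_costs:
  fixes B :: "'n::finite set" and a :: "'n \<times> 'n \<Rightarrow> real"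
  assumes "B \<noteq> {}"
  obtains p where "presents_local_tls (card B) p B" "\<And>e. e \<in> B \<times> -B \<Longrightarrow> exchange_cost p B e = ereal (a e)"
proof -
  define w where "w r e = (if e \<in> B then if e = r then 0 else \<infinity> else ereal (a (r, e)))" for r e
  define p where "p = min_matching w B"
  have wn: "w r e \<noteq> -\<infinity>" for r e by (simp add: w_def)
  have pB: "p B = 0"
  proof (rule antisym)
    have "p B \<le> (\<Sum>r\<in>B. w r (id r))" unfolding p_def by (rule min_matching_le[OF bij_betw_id])
    also have "\<dots> = 0" by (intro sum.neutral) (simp add: w_def)
    finally show "p B \<le> 0" .
    obtain \<sigma> where \<sigma>: "bij_betw \<sigma> B B" "p B = (\<Sum>r\<in>B. w r (\<sigma> r))"
      using min_matching_attained[of B B w] unfolding p_def by metis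
    have "\<sigma> r \<in> B" if "r \<in> B" for r using \<sigma>(1) that by (auto simp: bij_betw_def)
    then show "0 \<le> p B" unfolding \<sigma>(2) by (intro sum_nonneg) (simp add: w_def)
  qed
  have pe: "p (insert c (B - {b})) = ereal (a (b, c))" if b: "b \<in> B" and c: "c \<notin> B" for b c
  proof (rule antisym)
    have id: "bij_betw (id(b := c)) B (insert c (B - {b}))"
      unfolding bij_betw_def
    proof
      show "inj_on (id(b := c)) B" using c by (auto simp: inj_on_def)
      show "id(b := c) ` B = insert c (B - {b})" using b by auto
    qed
    have "p (insert c (B - {b})) \<le> (\<Sum>r\<in>B. w r ((id(b := c)) r))"
      unfolding p_def by (rule min_matching_le[OF id])
    also have "\<dots> = w b c + (\<Sum>r\<in>B - {b}. w r ((id(b := c)) r))" using b by (simp add: sum.remove)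
    also have "(\<Sum>r\<in>B - {b}. w r ((id(b := c)) r)) = 0" by (intro sum.neutral) (simp add: w_def)
    finally show "p (insert c (B - {b})) \<le> ereal (a (b, c))" using c by (simp add: w_def)
    have "card B = card (insert c (B - {b}))" using card_exchange[OF b c] by simp
    then obtain \<sigma> where \<sigma>: "bij_betw \<sigma> B (insert c (B - {b}))" "p (insert c (B - {b})) = (\<Sum>r\<in>B. w r (\<sigma> r))"
      using min_matching_attained[of B "insert c (B - {b})" w] unfolding p_def by metis
    show "ereal (a (b, c)) \<le> p (insert c (B - {b}))"
    proof (cases "\<exists>r\<in>B. w r (\<sigma> r) = \<infinity>")
      case True
      then have "p (insert c (B - {b})) = \<infinity>" unfolding \<sigma>(2) by (auto simp: sum_Pinfty)
      then show ?thesis by simp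
    next
      case False
      have fix_or_c: "\<sigma> r = r \<or> \<sigma> r = c" if "r \<in> B" for r
      proof -
        have "\<sigma> r \<in> insert c (B - {b})" using \<sigma>(1) that by (auto simp: bij_betw_def)
        then show ?thesis using False that by (auto simp: w_def split: if_splits)
      qed
      have "\<sigma> b \<noteq> b" using bij_betwE[OF \<sigma>(1)] b c by force
      then have sb: "\<sigma> b = c" using fix_or_c b by blast
      have "\<sigma> r = r" if "r \<in> B - {b}" for r
        using fix_or_c[of r] that sb \<sigma>(1) b by (auto simp: bij_betw_def inj_on_def)
      then have "(\<Sum>r\<in>B - {b}. w r (\<sigma> r)) = 0" by (intro sum.neutral) (simp add: w_def)
      then have "p (insert c (B - {b})) = w b c"
        unfolding \<sigma>(2) using b sb by (simp add: sum.remove)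
      then show ?thesis using c by (simp add: w_def)
    qed
  qed
  show thesis
  proof
    have pl: "trop_plucker (card B) p"
      unfolding p_def using pB wn by (intro trop_plucker_min_matching[of w B B]) (auto simp: p_def)
    have BB: "B \<in> bases (card B) p" using pB by (simp add: bases_def)
    obtain b where b: "b \<in> B" using assms by blast
    have "\<not> is_loop (bases (card B) p) e" for e
    proof (cases "e \<in> B")
      case True then show ?thesis using BB by (auto simp: is_loop_def)
    next
      case False
      have "insert e (B - {b}) \<in> bases (card B) p"
        using pe[OF b False] card_exchange[OF b False] by (simp add: bases_def)
      then show ?thesis by (auto simp: is_loop_def)
    qed
    then show "presents_local_tls (card B) p B" using pl BB by (simp add: presents_local_tls_def)
    show "exchange_cost p B e = ereal (a e)" if "e \<in> B \<times> -B" for e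
      using that pe pB by (auto simp: exchange_cost_def)
  qed
qed

section \<open>Face numbers\<close>


text \<open>
  If \<open>m + i > n\<close>, all three expressions vanish: the first by convention, the others because one of the
  factors has a lower index exceeding the upper one.
\<close>

lemma multinomial_eq_bounded:
  fixes n m i :: nat
  assumes "1 \<le> i" "i \<le> m" "m < n"
  shows "multinomial3 (n - i - 1) (int n - int m - int i) (int i - 1) (int m - int i)
      = real (((n - i - 1) choose (m - i)) * ((n - m - 1) choose (i - 1)))"
    and "multinomial3 (n - i - 1) (int n - int m - int i) (int i - 1) (int m - int i)
      = real (((n - i - 1) choose (i - 1)) * ((n - 2 * i) choose (m - i)))"
proof -
  let ?L = "multinomial3 (n - i - 1) (int n - int m - int i) (int i - 1) (int m - int i)"
  have "?L = real (((n - i - 1) choose (m - i)) * ((n - m - 1) choose (i - 1)))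
      \<and> ?L = real (((n - i - 1) choose (i - 1)) * ((n - 2 * i) choose (m - i)))"
  proof (cases "m + i \<le> n")
    case False
    then have "?L = 0" by (simp add: multinomial3_def)
    moreover have "(n - m - 1) choose (i - 1) = 0" using False assms by (intro binomial_eq_0) linarith
    moreover have "(n - i - 1) choose (i - 1) = 0 \<or> (n - 2 * i) choose (m - i) = 0"
    proof (cases "2 * i \<le> n")
      case True
      then have "n - 2 * i < m - i" using False by linarith
      then show ?thesis by (simp add: binomial_eq_0)
    next
      case 2: False
      then have "n - i - 1 < i - 1" using assms by linarith
      then show ?thesis by (simp add: binomial_eq_0)
    qed
    ultimately show ?thesis by auto
  next
    case True
    have L: "?L = fact (n - i - 1) / (fact (n - m - i) * fact (i - 1) * fact (m - i))"
    proof -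
      have "nat (int n - int m - int i) = n - m - i" "nat (int i - 1) = i - 1" "nat (int m - int i) = m - i"
        using True assms by linarith+
      then show ?thesis using True assms by (simp add: multinomial3_def)
    qed
    have e: "n - i - 1 - (m - i) = n - m - 1" "n - m - 1 - (i - 1) = n - m - i"
      "n - i - 1 - (i - 1) = n - 2 * i" "n - 2 * i - (m - i) = n - m - i"
      and le: "m - i \<le> n - i - 1" "i - 1 \<le> n - m - 1" "i - 1 \<le> n - i - 1" "m - i \<le> n - 2 * i"
      using True assms by linarith+
    show ?thesis
      unfolding L of_nat_mult binomial_fact[OF le(1)] binomial_fact[OF le(2)] binomial_fact[OF le(3)]
        binomial_fact[OF le(4)] e
      by simp
  qed
  then show "?L = real (((n - i - 1) choose (m - i)) * ((n - m - 1) choose (i - 1)))"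
    and "?L = real (((n - i - 1) choose (i - 1)) * ((n - 2 * i) choose (m - i)))" by auto
qed

lemma multinomial_eq_all:
  fixes n m i :: nat
  assumes "1 \<le> i" "i \<le> m" "m < n"
  shows "(real n - real m) / (real n - real i) * multinomial3 (n - 1) (int n - int m) (int i - 1) (int m - int i)
      = real (((n - i - 1) choose (m - i)) * ((n - 1) choose (i - 1)))"
proof -
  have e: "n - i - 1 - (m - i) = n - m - 1" "n - 1 - (i - 1) = n - i"
    and le: "m - i \<le> n - i - 1" "i - 1 \<le> n - 1"
    using assms by linarith+
  have f: "fact (n - m) = (real n - real m) * fact (n - m - 1)" "fact (n - i) = (real n - real i) * fact (n - i - 1)"
    using assms fact_reduce[of "n - m", where 'a = real] fact_reduce[of "n - i", where 'a = real] by simp_all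
  have "nat (int n - int m) = n - m" "nat (int i - 1) = i - 1" "nat (int m - int i) = m - i"
    using assms by linarith+
  then have L: "multinomial3 (n - 1) (int n - int m) (int i - 1) (int m - int i)
      = fact (n - 1) / (fact (n - m) * fact (i - 1) * fact (m - i))"
    using assms by (simp add: multinomial3_def)
  have cancel: "k / l * (N / (k * A * s * t)) = F / (t * A) * (N / (s * (l * F)))"
    if "k \<noteq> 0" "F \<noteq> 0" for k l N A s t F :: real
    using that by simp
  show ?thesis
    unfolding L of_nat_mult binomial_fact[OF le(1)] binomial_fact[OF le(2)] e f
    by (rule cancel) (use assms in simp_all)
qed

lemma face_numbers_le:
  fixes B :: "'n::finite set"
  assumes p: "presents_local_tls m p B" and m: "m < CARD('n)" and i: "1 \<le> i" "i \<le> m"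
  shows "num_faces m p B i \<le> ((CARD('n) - i - 1) choose (m - i)) * ((CARD('n) - 1) choose (i - 1))"
    and "num_bounded_faces m p B i \<le> ((CARD('n) - i - 1) choose (m - i)) * ((CARD('n) - m - 1) choose (i - 1))"
proof -
  have cB: "card B = m" using p by (auto simp: presents_local_tls_def bases_def)
  have "B \<noteq> UNIV" "B \<noteq> {}" using cB m i by auto
  then have ne: "-B \<noteq> {}" "B \<noteq> {}" by blast+
  let ?a = "exchange_cost p B"
  obtain a' \<phi> where gen: "generic_costs B a'" and inj: "inj_on \<phi> (tight_graphs B ?a)"
    and im: "\<phi> ` tight_graphs B ?a \<subseteq> tight_graphs B (\<lambda>e. ereal (a' e))"
    and dim: "\<And>G. G \<in> tight_graphs B ?a \<Longrightarrow> constant_along (\<phi> G) = (constant_along G :: (real ^ 'n) set)"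
    and cov: "\<And>G. G \<in> tight_graphs B ?a \<Longrightarrow> fst ` \<phi> G = fst ` G"
    using embed_into_generic[of B ?a] by blast
  note nums = generic_graph_numbers[OF gen ne, of i, unfolded cB, OF i]
  show "num_faces m p B i \<le> ((CARD('n) - i - 1) choose (m - i)) * ((CARD('n) - 1) choose (i - 1))"
    unfolding num_faces_eq(1)[OF p] nums(1)[symmetric]
    by (rule card_inj_on_le[of \<phi>]) (use inj im dim in \<open>auto intro: inj_on_subset\<close>)
  show "num_bounded_faces m p B i \<le> ((CARD('n) - i - 1) choose (m - i)) * ((CARD('n) - m - 1) choose (i - 1))"
    unfolding num_faces_eq(2)[OF p] nums(2)[symmetric]
  proof (rule card_inj_on_le[of \<phi>])
    show "\<phi> ` {G \<in> tight_graphs B ?a. dim (constant_along G :: (real ^ 'n) set) = i \<and> bounded_mod_ones (closure (cell B ?a G))}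
      \<subseteq> {G \<in> tight_graphs B (\<lambda>e. ereal (a' e)). B \<subseteq> fst ` G \<and> dim (constant_along G :: (real ^ 'n) set) = i}"
    proof (rule image_subsetI)
      fix G assume "G \<in> {G \<in> tight_graphs B ?a. dim (constant_along G :: (real ^ 'n) set) = i
          \<and> bounded_mod_ones (closure (cell B ?a G))}"
      then have G: "G \<in> tight_graphs B ?a" "dim (constant_along G :: (real ^ 'n) set) = i"
        "bounded_mod_ones (closure (cell B ?a G))" by auto
      have "B \<subseteq> fst ` G" by (rule bounded_imp_covers[OF G(1,3) ne(1)])
      then show "\<phi> G \<in> {G \<in> tight_graphs B (\<lambda>e. ereal (a' e)). B \<subseteq> fst ` G
          \<and> dim (constant_along G :: (real ^ 'n) set) = i}"
        using im dim[OF G(1)] cov[OF G(1)] G(1,2) by auto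
    qed
  qed (use inj in \<open>auto intro: inj_on_subset\<close>)
qed

lemma cell_cong:
  assumes "\<And>e. e \<in> B \<times> -B \<Longrightarrow> a e = a' e"
  shows "cell B a = cell B a'" and "tight_graphs B a = tight_graphs B a'"
proof -
  have t: "tight B a = tight B a'" using assms by (auto simp: tight_def fun_eq_iff)
  have f: "feasible B a = feasible B a'" using assms by (auto simp: feasible_def fun_eq_iff)
  show "cell B a = cell B a'" "tight_graphs B a = tight_graphs B a'"
    by (simp_all add: cell_def[abs_def] tight_graphs_def min_graph_def t f)
qed

lemma face_numbers_attained:
  assumes m: "1 \<le> m" "m < CARD('n::finite)"
  obtains p :: "'n::finite set \<Rightarrow> ereal" and B where "presents_local_tls m p B"
    "\<And>i. 1 \<le> i \<Longrightarrow> i \<le> m \<Longrightarrow>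
       num_faces m p B i = ((CARD('n) - i - 1) choose (m - i)) * ((CARD('n) - 1) choose (i - 1))"
    "\<And>i. 1 \<le> i \<Longrightarrow> i \<le> m \<Longrightarrow>
       num_bounded_faces m p B i = ((CARD('n) - i - 1) choose (m - i)) * ((CARD('n) - m - 1) choose (i - 1))"
proof -
  obtain B :: "'n set" where cB: "card B = m" using m obtain_subset_with_card_n[of m "UNIV :: 'n set"] by auto
  have "B \<noteq> UNIV" "B \<noteq> {}" using cB m by auto
  then have ne: "-B \<noteq> {}" "B \<noteq> {}" by blast+
  obtain a where gen: "generic_costs B a" using exists_generic_costs by blast
  obtain p where p: "presents_local_tls m p B" and pe: "\<And>e. e \<in> B \<times> -B \<Longrightarrow> exchange_cost p B e = ereal (a e)"
    using exists_plucker_with_costs[OF ne(2), of a] cB by metis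
  note nums = generic_graph_numbers[OF gen ne, unfolded cB]
  have cong: "cell B (exchange_cost p B) = cell B (\<lambda>e. ereal (a e))"
    "tight_graphs B (exchange_cost p B) = tight_graphs B (\<lambda>e. ereal (a e))"
    by (rule cell_cong(1), erule pe) (rule cell_cong(2), erule pe)
  have bounded_iff: "bounded_mod_ones (closure (cell B (\<lambda>e. ereal (a e)) G)) \<longleftrightarrow> B \<subseteq> fst ` G"
    if "G \<in> tight_graphs B (\<lambda>e. ereal (a e))" for G
    using bounded_imp_covers[OF that _ ne(1)] covers_imp_bounded[OF that] by blast
  show thesis
  proof (rule that[OF p])
    fix i assume i: "1 \<le> i" "i \<le> m"
    show "num_faces m p B i = ((CARD('n) - i - 1) choose (m - i)) * ((CARD('n) - 1) choose (i - 1))"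
      unfolding num_faces_eq(1)[OF p] cong by (rule nums(1)[OF i])
    have "{G \<in> tight_graphs B (\<lambda>e. ereal (a e)). dim (constant_along G :: (real ^ 'n) set) = i
          \<and> bounded_mod_ones (closure (cell B (\<lambda>e. ereal (a e)) G))}
        = {G \<in> tight_graphs B (\<lambda>e. ereal (a e)). B \<subseteq> fst ` G \<and> dim (constant_along G :: (real ^ 'n) set) = i}"
      using bounded_iff by blast
    then show "num_bounded_faces m p B i = ((CARD('n) - i - 1) choose (m - i)) * ((CARD('n) - m - 1) choose (i - 1))"
      unfolding num_faces_eq(2)[OF p] cong using nums(2)[OF i] by simp
  qed
qed

theorem proposition3p4:
  fixes n m :: nat
  assumes "CARD('n::finite) = n" and "1 \<le> m" and "m < n"
  shows
    "(\<forall>i\<in>{1..m}. \<forall>(p :: 'n set \<Rightarrow> ereal) B. presents_local_tls m p B \<longrightarrow>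
        real (num_bounded_faces m p B i)
          \<le> multinomial3 (n - i - 1) (int n - int m - int i) (int i - 1) (int m - int i) \<and>
        real (num_faces m p B i)
          \<le> (real n - real m) / (real n - real i)
              * multinomial3 (n - 1) (int n - int m) (int i - 1) (int m - int i)) \<and>
     (\<forall>i\<in>{1..m}.
        multinomial3 (n - i - 1) (int n - int m - int i) (int i - 1) (int m - int i)
          = real (((n - i - 1) choose (i - 1)) * ((n - 2 * i) choose (m - i))) \<and>
        (real n - real m) / (real n - real i)
            * multinomial3 (n - 1) (int n - int m) (int i - 1) (int m - int i)
          = real (((n - i - 1) choose (m - i)) * ((n - 1) choose (i - 1)))) \<and>
     (\<exists>(p :: 'n set \<Rightarrow> ereal) B. presents_local_tls m p B \<and>
        (\<forall>i\<in>{1..m}.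
          real (num_bounded_faces m p B i)
            = multinomial3 (n - i - 1) (int n - int m - int i) (int i - 1) (int m - int i) \<and>
          real (num_faces m p B i)
            = (real n - real m) / (real n - real i)
                * multinomial3 (n - 1) (int n - int m) (int i - 1) (int m - int i)))"
proof (intro conjI ballI allI impI)
  fix i assume "i \<in> {1..m}"
  then have i: "1 \<le> i" "i \<le> m" by auto
  note bounded = multinomial_eq_bounded[OF i assms(3)] and all = multinomial_eq_all[OF i assms(3)]
  have m: "m < CARD('n)" using assms by simp
  show "real (num_bounded_faces m p B i)
      \<le> multinomial3 (n - i - 1) (int n - int m - int i) (int i - 1) (int m - int i)"
    and "real (num_faces m p B i)
      \<le> (real n - real m) / (real n - real i)
          * multinomial3 (n - 1) (int n - int m) (int i - 1) (int m - int i)"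
    if "presents_local_tls m p B" for p :: "'n set \<Rightarrow> ereal" and B
    unfolding bounded(1) all of_nat_le_iff using face_numbers_le[OF that m i] assms(1) by simp_all
  show "multinomial3 (n - i - 1) (int n - int m - int i) (int i - 1) (int m - int i)
      = real (((n - i - 1) choose (i - 1)) * ((n - 2 * i) choose (m - i)))"
    by (rule bounded(2))
  show "(real n - real m) / (real n - real i)
        * multinomial3 (n - 1) (int n - int m) (int i - 1) (int m - int i)
      = real (((n - i - 1) choose (m - i)) * ((n - 1) choose (i - 1)))"
    by (rule all)
next
  have m: "m < CARD('n)" using assms by simp
  obtain p :: "'n set \<Rightarrow> ereal" and B where p: "presents_local_tls m p B"
    and f: "\<And>i. 1 \<le> i \<Longrightarrow> i \<le> m \<Longrightarrow>
       num_faces m p B i = ((CARD('n) - i - 1) choose (m - i)) * ((CARD('n) - 1) choose (i - 1))"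
    and b: "\<And>i. 1 \<le> i \<Longrightarrow> i \<le> m \<Longrightarrow>
       num_bounded_faces m p B i = ((CARD('n) - i - 1) choose (m - i)) * ((CARD('n) - m - 1) choose (i - 1))"
    using face_numbers_attained[OF assms(2) m] by blast
  show "\<exists>(p :: 'n set \<Rightarrow> ereal) B. presents_local_tls m p B \<and>
        (\<forall>i\<in>{1..m}.
          real (num_bounded_faces m p B i)
            = multinomial3 (n - i - 1) (int n - int m - int i) (int i - 1) (int m - int i) \<and>
          real (num_faces m p B i)
            = (real n - real m) / (real n - real i)
                * multinomial3 (n - 1) (int n - int m) (int i - 1) (int m - int i))"
  proof (intro exI[of _ p] exI[of _ B] conjI ballI p)
    fix i assume "i \<in> {1..m}"
    then have i: "1 \<le> i" "i \<le> m" by auto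
    show "real (num_bounded_faces m p B i)
        = multinomial3 (n - i - 1) (int n - int m - int i) (int i - 1) (int m - int i)"
      unfolding multinomial_eq_bounded(1)[OF i assms(3)] b[OF i] assms(1) ..
    show "real (num_faces m p B i)
        = (real n - real m) / (real n - real i)
            * multinomial3 (n - 1) (int n - int m) (int i - 1) (int m - int i)"
      unfolding multinomial_eq_all[OF i assms(3)] f[OF i] assms(1) ..
  qed
qed

end
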